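(* Let $\mathbf{W}=\{\mathbf{W}(t):t\ge 0\}$ be standard planar Brownian motion started at the origin, and for $t\ge 0$ let $\mathsf{R}(t)$ be the circumradius of $\mathrm{H}(t)=\operatorname{conv}\{\mathbf{W}(s):s\in[0,t]\}$. Let $\Theta^{\mathsf{R}}=\inf\{t\ge 0:\mathsf{R}(t)>1\}$. Then $$0.7213\approx\frac{1}{2\log 2}\le \mathbb{E}\left[\Theta^{\mathsf{R}}\right]\le 4\mathfrak{r}\approx 1.3863,$$ where $\mathfrak{r}=\mathbb{E}\left[\min\{\Theta^{R_1},\Theta^{R_2}\}\right]$ and $\Theta^{R_i}$ is the first time the range of the $i$-th coordinate of $\mathbf{W}$ exceeds $1$.
   Context: Standard planar Brownian motion is $\mathbf{W}(t)=(W_1(t),W_2(t))$ with $W_1,W_2$ independent one-dimensional standard Brownian motions started at $0$. $\operatorname{conv}A$ is the convex hull of $A\subset\mathbb{R}^2$. The circumradius of a bounded set is the radius of the smallest disk containing it. For $i=1,2$, $R_i(t)=\sup_{0\le s\le t}W_i(s)-\inf_{0\le s\le t}W_i(s)$ (not to be confused with $\mathsf{R}(t)$) and $\Theta^{R_i}=\inf\{t\ge 0:R_i(t)>1\}$. The constant $\mathfrak{r}$ satisfies $$\mathfrak{r}=\frac12-\frac{2}{\pi}\int_0^\infty\left(1-\frac{4}{(\cos t+\cosh t)^2}\right)\frac{1}{t^3}\,dt\approx 0.346554.$$ $\log$ is the natural logarithm; the symbol $\approx$ only indicates a numerical approximation of the exact expression. *)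

theory Defs
  imports "HOL-Probability.Probability"
begin

locale standard_brownian_motion = prob_space M
  for M :: "'a measure" +
  fixes B :: "real \<Rightarrow> 'a \<Rightarrow> real"
  assumes measurable: "\<And>t. 0 \<le> t \<Longrightarrow> B t \<in> borel_measurable M"
    and start_0: "AE \<omega> in M. B 0 \<omega> = 0"
    and indep_increments:
      "\<And>(t :: nat \<Rightarrow> real) n. 0 \<le> t 0 \<Longrightarrow> (\<And>i. i < n \<Longrightarrow> t i < t (Suc i)) \<Longrightarrow>
         indep_vars (\<lambda>_. borel) (\<lambda>i \<omega>. B (t (Suc i)) \<omega> - B (t i) \<omega>) {..<n}"
    and normal_increments:
      "\<And>s t. 0 \<le> s \<Longrightarrow> s < t \<Longrightarrow>
         distributed M lborel (\<lambda>\<omega>. B t \<omega> - B s \<omega>) (normal_density 0 (sqrt (t - s)))"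
    and continuous_paths: "AE \<omega> in M. continuous_on {0..} (\<lambda>t. B t \<omega>)"

text \<open>The two coordinates are independent as processes, that is, as random elements of the
  product space indexed by all times \<open>t \<ge> 0\<close>.\<close>

locale planar_brownian_motion = prob_space M
  for M :: "'a measure" +
  fixes W :: "real \<Rightarrow> 'a \<Rightarrow> real ^ 2"
  assumes coord_1: "standard_brownian_motion M (\<lambda>t \<omega>. W t \<omega> $ 1)"
    and coord_2: "standard_brownian_motion M (\<lambda>t \<omega>. W t \<omega> $ 2)"
    and indep_coords:
      "indep_var (\<Pi>\<^sub>M t\<in>{0..}. borel) (\<lambda>\<omega>. \<lambda>t\<in>{0..}. W t \<omega> $ 1)
                 (\<Pi>\<^sub>M t\<in>{0..}. borel) (\<lambda>\<omega>. \<lambda>t\<in>{0..}. W t \<omega> $ 2)"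

text \<open>The value is meaningful for bounded sets only; for those the infimum is attained, see
  \<open>circumradius_attained\<close> below, so that it is the radius of a smallest disk.\<close>

definition circumradius :: "'a :: metric_space set \<Rightarrow> real" where
  "circumradius S = Inf {r. 0 \<le> r \<and> (\<exists>c. S \<subseteq> cball c r)}"

lemma circumradius_attained:
  fixes S :: "'a :: heine_borel set"
  assumes "bounded S"
  shows "0 \<le> circumradius S" "\<exists>c. S \<subseteq> cball c (circumradius S)"
proof -
  define A where "A = {r. 0 \<le> r \<and> (\<exists>c. S \<subseteq> cball c r)}"
  obtain c0 r0 where "S \<subseteq> cball c0 r0" "0 \<le> r0"
    using assms by (metis bounded_subset_cball)
  then have ne: "A \<noteq> {}" by (auto simp: A_def)
  have bdd: "bdd_below A" by (auto simp: A_def bdd_below_def)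
  have R: "circumradius S = Inf A" by (simp add: circumradius_def A_def)
  show "0 \<le> circumradius S"
    unfolding R using ne by (intro cInf_greatest) (auto simp: A_def)
  show "\<exists>c. S \<subseteq> cball c (circumradius S)"
  proof (cases "S = {}")
    case False
    then obtain x where x: "x \<in> S" by auto
    have "\<exists>r\<in>A. r < Inf A + 1 / real (Suc n)" for n
      using cInf_lessD[OF ne, of "Inf A + 1 / real (Suc n)"] by auto
    then obtain r where r: "\<And>n. r n \<in> A" "\<And>n. r n < Inf A + 1 / real (Suc n)"
      by metis
    then have "\<forall>n. \<exists>c. S \<subseteq> cball c (r n)" by (auto simp: A_def)
    then obtain c where c: "\<And>n. S \<subseteq> cball (c n) (r n)" by metis
    have "c n \<in> cball x (Inf A + 1)" for n
    proof -
      have "dist (c n) x \<le> r n" using c x by (auto simp: subset_iff)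
      also have "\<dots> \<le> Inf A + 1 / real (Suc n)" using r(2)[of n] by simp
      also have "\<dots> \<le> Inf A + 1" by simp
      finally show ?thesis by (simp add: dist_commute)
    qed
    then obtain l f where f: "strict_mono (f :: nat \<Rightarrow> nat)" "(c \<circ> f) \<longlonglongrightarrow> l"
      using compact_cball[of x "Inf A + 1"] unfolding compact_def by metis
    have "dist l y \<le> Inf A" if "y \<in> S" for y
    proof (rule LIMSEQ_le)
      show "(\<lambda>n. dist ((c \<circ> f) n) y) \<longlonglongrightarrow> dist l y" by (intro tendsto_intros f)
      have "((\<lambda>n. 1 / real (Suc n)) \<circ> f) \<longlonglongrightarrow> 0"
        using LIMSEQ_subseq_LIMSEQ[OF lim_1_over_n[THEN LIMSEQ_Suc] f(1)]
        by (simp add: o_def)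
      then show "(\<lambda>n. Inf A + 1 / real (Suc (f n))) \<longlonglongrightarrow> Inf A"
        using tendsto_add[OF tendsto_const[of "Inf A"]] by (fastforce simp: o_def)
      have "dist ((c \<circ> f) n) y \<le> Inf A + 1 / real (Suc (f n))" for n
        using c[of "f n"] that r(2)[of "f n"] by (force simp: subset_iff)
      then show "\<exists>N. \<forall>n\<ge>N. dist ((c \<circ> f) n) y \<le> Inf A + 1 / real (Suc (f n))" by blast
    qed
    then show ?thesis unfolding R by (auto simp: subset_iff)
  qed auto
qed

definition hull_process :: "(real \<Rightarrow> 'a \<Rightarrow> real ^ 2) \<Rightarrow> real \<Rightarrow> 'a \<Rightarrow> (real ^ 2) set" where
  "hull_process W t \<omega> = convex hull ((\<lambda>s. W s \<omega>) ` {0..t})"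

definition circumradius_process :: "(real \<Rightarrow> 'a \<Rightarrow> real ^ 2) \<Rightarrow> real \<Rightarrow> 'a \<Rightarrow> real" where
  "circumradius_process W t \<omega> = circumradius (hull_process W t \<omega>)"

definition coord_range :: "(real \<Rightarrow> 'a \<Rightarrow> real ^ 2) \<Rightarrow> 2 \<Rightarrow> real \<Rightarrow> 'a \<Rightarrow> real" where
  "coord_range W i t \<omega> = (SUP s\<in>{0..t}. W s \<omega> $ i) - (INF s\<in>{0..t}. W s \<omega> $ i)"

text \<open>The passage time takes values in \<open>[0, \<infinity>]\<close>; it is \<open>\<infinity>\<close> if the level \<open>1\<close> is never exceeded.\<close>

definition passage_time :: "(real \<Rightarrow> 'a \<Rightarrow> real) \<Rightarrow> 'a \<Rightarrow> ennreal" where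
  "passage_time X \<omega> = (INF t\<in>{t. 0 \<le> t \<and> X t \<omega> > 1}. ennreal t)"

text \<open>Expectations of passage times are taken with the nonnegative integral, so no integrability
  is presupposed. Its value does not change on modifying the integrand on a null set, also where
  the integrand fails to be measurable because paths are only almost surely continuous.\<close>

definition range_constant :: "'a measure \<Rightarrow> (real \<Rightarrow> 'a \<Rightarrow> real ^ 2) \<Rightarrow> ennreal" where
  "range_constant M W =
     (\<integral>\<^sup>+\<omega>. min (passage_time (coord_range W 1) \<omega>) (passage_time (coord_range W 2) \<omega>) \<partial>M)"

end

theory Submission
  imports Defs
begin

text \<open>Write \<open>R\<^sub>i(t)\<close> for the range of the \<open>i\<close>-th coordinate. On a continuous path the hull is contained in a
  rectangle with sides \<open>R\<^sub>1(t), R\<^sub>2(t)\<close> and touches all its sides, so the circumradius lies between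
  \<open>max (R\<^sub>1(t)) (R\<^sub>2(t)) / 2\<close> and \<open>sqrt (R\<^sub>1(t)\<^sup>2 + R\<^sub>2(t)\<^sup>2) / 2\<close>. For a homogeneous increasing function \<open>Q\<close> of the
  two ranges, Brownian scaling gives \<open>E \<Theta>\<^sup>Q = E [1 / Q(1)\<^sup>2]\<close>. With \<open>Q = max / 2\<close> this is the upper bound; with
  the half diagonal, Jensen's inequality and Feller's \<open>E R\<^sub>i(1)\<^sup>2 \<le> 4 ln 2\<close> give the lower bound.

  Feller's bound follows from \<open>E [max * (- min)] \<le> 2 ln 2 - 1\<close>, which is the integral over \<open>a, b > 0\<close> of the
  reflection series for the probability of passing both \<open>a\<close> and \<open>-b\<close>, truncated after an even term. No strong
  Markov property is needed: the series is a caloric function, and on a Gaussian random walk sampled from the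
  path it is a supersolution of the hitting problem up to an overshoot error that vanishes with the step
  size.\<close>

section \<open>Gaussian measures and tails\<close>

text \<open>A Gaussian step averages each tail exactly, at every position on the line, so a walk can
  lose against the series only where it jumps over a level. A jump of length at most e overshoots by
  at most e, and this Lipschitz error is charged once through \<open>\<kappa>\<close>. A longer jump
  is paid at every step through its fourth moment, of order h^2 / e^4 for step variance h; over t /
  h steps this adds up to order h and vanishes, whereas second moments would leave a constant. The
  Lipschitz constant of \<open>gtail v\<close> blows up as v tends to 0, so the path is observed up
  to a time t < 1 and the variance 1 - t is kept in reserve; t tends to 1 only in the final bound.
  The constants: each extremum has second moment at most 1, whence 1 + 1 + 2 (2 ln 2 - 1) = 4 ln 2,
  and the squared half diagonal has mean at most (4 ln 2 + 4 ln 2) / 4 = 2 ln 2, the reciprocal of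
  the lower bound. Scaling is proved on dyadic grids, where the law of the range divided by sqrt t
  is independent of t, and passes to the path because grid ranges increase to the true
  range.\<close>

definition gauss :: "real \<Rightarrow> real measure" where
  "gauss v = density lborel (normal_density 0 (sqrt v))"

lemma sets_gauss [simp, measurable_cong]: "sets (gauss v) = sets borel"
  and space_gauss [simp]: "space (gauss v) = UNIV"
  by (simp_all add: gauss_def)

lemma prob_space_gauss: "0 < v \<Longrightarrow> prob_space (gauss v)"
  unfolding gauss_def by (rule prob_space_normal_density) simp

lemma nn_integral_gauss:
  "f \<in> borel_measurable borel \<Longrightarrow>
     (\<integral>\<^sup>+x. f x \<partial>gauss v) = (\<integral>\<^sup>+x. ennreal (normal_density 0 (sqrt v) x) * f x \<partial>lborel)"
  unfolding gauss_def by (rule nn_integral_density) simp_all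

lemma integral_gauss:
  fixes f :: "real \<Rightarrow> real"
  shows "f \<in> borel_measurable borel \<Longrightarrow>
     (\<integral>x. f x \<partial>gauss v) = (\<integral>x. normal_density 0 (sqrt v) x * f x \<partial>lborel)"
  unfolding gauss_def by (subst integral_density) (simp_all)

lemma integrable_gauss_bounded:
  fixes f :: "real \<Rightarrow> real"
  assumes "0 < v" "f \<in> borel_measurable borel" "\<And>x. \<bar>f x\<bar> \<le> C"
  shows "integrable (gauss v) f"
proof -
  interpret prob_space "gauss v" by (rule prob_space_gauss) fact
  show ?thesis using assms by (intro integrable_const_bound[of _ C]) auto
qed

text \<open>The second moment fixes the value in \<open>nn_integral_gtail_quadrant\<close>; the
  fourth prices long jumps in \<open>hit_value_step\<close>.\<close>

lemma gauss_moment: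
  assumes "0 < v"
  shows "has_bochner_integral (gauss v) (\<lambda>x. x ^ 2) v"
    and "has_bochner_integral (gauss v) (\<lambda>x. x ^ 4) (3 * v\<^sup>2)"
proof -
  have 1: "fact (2 * k) / ((2 / (sqrt v)\<^sup>2) ^ k * fact k) = (if k = 1 then v else 3 * v\<^sup>2)"
    if "k = 1 \<or> k = 2" for k :: nat
    using assms that by (auto simp: fact_numeral field_simps power2_eq_square)
  have "has_bochner_integral (gauss v) (\<lambda>x. x ^ (2 * k)) (if k = 1 then v else 3 * v\<^sup>2)"
    if "k = 1 \<or> k = 2" for k :: nat
    unfolding gauss_def
    using normal_moment_even[of "sqrt v" 0 k] 1[OF that] assms
    by (intro has_bochner_integral_density) auto
  from this[of 1] this[of 2]
  show "has_bochner_integral (gauss v) (\<lambda>x. x ^ 2) v"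
    "has_bochner_integral (gauss v) (\<lambda>x. x ^ 4) (3 * v\<^sup>2)" by simp_all
qed

lemma nn_integral_gauss_uminus:
  assumes [measurable]: "f \<in> borel_measurable borel"
  shows "(\<integral>\<^sup>+x. f (- x) \<partial>gauss v) = (\<integral>\<^sup>+x. f x \<partial>gauss v)"
proof -
  have "(\<integral>\<^sup>+x. f x \<partial>gauss v) = (\<integral>\<^sup>+x. ennreal (normal_density 0 (sqrt v) (- x)) * f (- x) \<partial>lborel)"
    by (subst nn_integral_gauss, simp, subst nn_integral_real_affine[where c="-1" and t=0]) auto
  also have "\<dots> = (\<integral>\<^sup>+x. f (- x) \<partial>gauss v)"
    by (subst nn_integral_gauss) (auto simp: normal_density_def)
  finally show ?thesis by simp
qed

lemma integral_gauss_uminus: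
  fixes f :: "real \<Rightarrow> real"
  assumes [measurable]: "f \<in> borel_measurable borel"
  shows "(\<integral>x. f (- x) \<partial>gauss v) = (\<integral>x. f x \<partial>gauss v)"
proof -
  have "(\<integral>x. f x \<partial>gauss v) = (\<integral>x. normal_density 0 (sqrt v) (- x) * f (- x) \<partial>lborel)"
    by (subst integral_gauss, simp, subst lborel_integral_real_affine[where c="-1" and t=0]) auto
  also have "\<dots> = (\<integral>x. f (- x) \<partial>gauss v)"
    by (subst integral_gauss) (auto simp: normal_density_def)
  finally show ?thesis by simp
qed

text \<open>By the reflection principle \<open>gtail v c\<close> is the probability that Brownian motion passes \<open>c \<ge> 0\<close> before time
  \<open>v\<close>; as a function of \<open>(v, c)\<close> it solves the heat equation on the whole line.\<close>

definition gtail :: "real \<Rightarrow> real \<Rightarrow> real" where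
  "gtail v c = 2 * measure (gauss v) {c<..}"

lemma gtail_nonneg: "0 \<le> gtail v c"
  by (simp add: gtail_def)

lemma gtail_le_2: "0 < v \<Longrightarrow> gtail v c \<le> 2"
  using prob_space.prob_le_1[OF prob_space_gauss] by (simp add: gtail_def)

lemma gtail_antimono: "0 < v \<Longrightarrow> c \<le> d \<Longrightarrow> gtail v d \<le> gtail v c"
proof -
  assume "0 < v" "c \<le> d"
  interpret prob_space "gauss v" by (rule prob_space_gauss) fact
  show ?thesis unfolding gtail_def
    using \<open>c \<le> d\<close> by (intro mult_left_mono finite_measure_mono) auto
qed

lemma borel_measurable_gtail: "0 < v \<Longrightarrow> gtail v \<in> borel_measurable borel"
proof -
  assume v: "0 < v"
  have "(\<lambda>x. - gtail v x) \<in> borel_measurable borel"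
    using gtail_antimono[OF v] by (intro borel_measurable_mono monoI) simp
  then have "(\<lambda>x. - (- gtail v x)) \<in> borel_measurable borel" by measurable
  then show ?thesis by simp
qed

lemma ennreal_gtail:
  assumes "0 < v" shows "ennreal (gtail v c) = 2 * emeasure (gauss v) {c<..}"
proof -
  interpret prob_space "gauss v" by (rule prob_space_gauss) fact
  show ?thesis by (simp add: gtail_def emeasure_eq_measure ennreal_mult')
qed

text \<open>Symmetry and the absence of an atom at 0 give \<open>gtail v 0 = 1\<close>. Once a level
  is passed, the tail thus dominates the probability 1 that it stands for; this lets a frozen tail
  serve as a supersolution.\<close>

lemma gtail_nonpos:
  assumes v: "0 < v" and "c \<le> 0"
  shows "1 \<le> gtail v c"
proof -
  interpret prob_space "gauss v" by (rule prob_space_gauss) fact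
  have "emeasure (gauss v) {0<..} = (\<integral>\<^sup>+x. indicator {0<..} (- x) \<partial>gauss v)"
    by (subst nn_integral_gauss_uminus) auto
  also have "\<dots> = (\<integral>\<^sup>+x. indicator {..<0} x \<partial>gauss v)"
    by (intro nn_integral_cong) (auto split: split_indicator)
  finally have sym: "measure (gauss v) {0<..} = measure (gauss v) {..<0}"
    by (simp add: measure_def)
  have "emeasure (gauss v) {0} = 0"
    unfolding gauss_def by (subst emeasure_density) (auto simp: nn_integral_null_set null_sets_def)
  then have "measure (gauss v) {0} = 0" by (simp add: measure_def)
  moreover have "1 = measure (gauss v) ({0<..} \<union> {..<0} \<union> {0})"
    using prob_space by (subst (asm) space_gauss) (metis UNIV_eq_I UnI1 UnI2 greaterThan_iff insertI1 lessThan_iff linorder_less_linear)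
  moreover have "\<dots> = measure (gauss v) {0<..} + measure (gauss v) {..<0} + measure (gauss v) {0}"
    by (subst finite_measure_Union, auto)+
  ultimately have "1 = gtail v 0" by (simp add: gtail_def sym)
  then show ?thesis using gtail_antimono[OF v \<open>c \<le> 0\<close>] by simp
qed

text \<open>The density of \<open>gauss v\<close> is at most 1 / sqrt (2 pi v), hence at most 1 / (2
  sqrt d) because 2 pi v \<ge> 4 d; the factor 2 in \<open>gtail\<close> turns this into 1 / sqrt d.
  The bound is uniform over all variances above the reserve \<open>d\<close>.\<close>

lemma gtail_lipschitz:
  assumes d: "0 < d" "d \<le> v" and "c \<le> c'"
  shows "gtail v c \<le> gtail v c' + (c' - c) / sqrt d"
proof -
  have v: "0 < v" using d by simp
  interpret prob_space "gauss v" by (rule prob_space_gauss) fact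
  have "measure (gauss v) {c<..} = measure (gauss v) ({c'<..} \<union> {c<..c'})"
    using \<open>c \<le> c'\<close> by (intro arg_cong[where f="measure (gauss v)"]) auto
  also have "\<dots> = measure (gauss v) {c'<..} + measure (gauss v) {c<..c'}"
    by (intro finite_measure_Union) auto
  finally have 1: "gtail v c = gtail v c' + 2 * measure (gauss v) {c<..c'}"
    by (simp add: gtail_def)
  have nd: "normal_density 0 (sqrt v) x \<le> 1 / (2 * sqrt d)" for x
  proof -
    have "2 * sqrt d \<le> sqrt (2 * pi * v)"
    proof (rule real_le_rsqrt)
      have "(2 * sqrt d)\<^sup>2 = 4 * d" using d by (simp add: power_mult_distrib)
      also have "\<dots> \<le> 2 * pi * v" using d pi_gt3 by (intro mult_mono) auto
      finally show "(2 * sqrt d)\<^sup>2 \<le> 2 * pi * v" .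
    qed
    moreover have "exp (- (x\<^sup>2 / (2 * v))) \<le> 1" using v by simp
    ultimately show ?thesis using v d
      by (auto simp: normal_density_def intro!: divide_mono frac_le)
  qed
  have "emeasure (gauss v) {c<..c'} = (\<integral>\<^sup>+x. ennreal (normal_density 0 (sqrt v) x) * indicator {c<..c'} x \<partial>lborel)"
    unfolding gauss_def by (subst emeasure_density) auto
  also have "\<dots> \<le> (\<integral>\<^sup>+x. ennreal (1 / (2 * sqrt d)) * indicator {c<..c'} x \<partial>lborel)"
    using nd by (intro nn_integral_mono mult_right_mono ennreal_leI) auto
  also have "\<dots> = ennreal (1 / (2 * sqrt d) * (c' - c))"
    using \<open>c \<le> c'\<close> d by (subst nn_integral_cmult_indicator) (auto simp: ennreal_mult'[symmetric])
  finally have "measure (gauss v) {c<..c'} \<le> 1 / (2 * sqrt d) * (c' - c)"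
    using \<open>c \<le> c'\<close> d by (simp add: emeasure_eq_measure)
  then show ?thesis using 1 by (simp add: field_simps)
qed

text \<open>Both sides are twice P(X + Y > c) for independent centred Gaussians of variances
  \<open>v\<close> and \<open>h\<close>; shifting the inner variable exhibits the convolution of the
  two densities. The sign of \<open>c\<close> is free, so the averaging identity also holds beyond
  the level.\<close>

lemma integral_gtail_diff:
  assumes v: "0 < v" and h: "0 < h"
  shows "(\<integral>y. gtail v (c - y) \<partial>gauss h) = gtail (v + h) c"
proof -
  note [measurable] = borel_measurable_gtail[OF v]
  have "ennreal (\<integral>y. gtail v (c - y) \<partial>gauss h) = (\<integral>\<^sup>+y. gtail v (c - y) \<partial>gauss h)"
    using gtail_nonneg gtail_le_2[OF v]
    by (intro nn_integral_eq_integral[symmetric] integrable_gauss_bounded[OF h, of _ 2]) auto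
  also have "\<dots> = (\<integral>\<^sup>+y. ennreal (normal_density 0 (sqrt h) y) * (2 * emeasure (gauss v) {c - y<..}) \<partial>lborel)"
    by (subst nn_integral_gauss) (auto simp: ennreal_gtail[OF v, symmetric])
  also have "\<dots> = (\<integral>\<^sup>+y. 2 * (\<integral>\<^sup>+x. ennreal (normal_density 0 (sqrt v) (x - y) * normal_density 0 (sqrt h) y) * indicator {c<..} x \<partial>lborel) \<partial>lborel)"
  proof (intro nn_integral_cong)
    fix y :: real
    have "emeasure (gauss v) {c - y<..} = (\<integral>\<^sup>+x. ennreal (normal_density 0 (sqrt v) x) * indicator {c - y<..} x \<partial>lborel)"
      unfolding gauss_def by (subst emeasure_density) auto
    also have "\<dots> = (\<integral>\<^sup>+x. ennreal (normal_density 0 (sqrt v) (x - y)) * indicator {c - y<..} (x - y) \<partial>lborel)"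
      by (subst nn_integral_real_affine[where c=1 and t="-y"]) auto
    finally have e: "emeasure (gauss v) {c - y<..} = (\<integral>\<^sup>+x. ennreal (normal_density 0 (sqrt v) (x - y)) * indicator {c - y<..} (x - y) \<partial>lborel)" .
    have "ennreal (normal_density 0 (sqrt h) y) * emeasure (gauss v) {c - y<..}
       = (\<integral>\<^sup>+x. ennreal (normal_density 0 (sqrt v) (x - y) * normal_density 0 (sqrt h) y) * indicator {c<..} x \<partial>lborel)"
      unfolding e
      by (subst nn_integral_cmult[symmetric])
         (auto intro!: nn_integral_cong simp: ennreal_mult' mult_ac split: split_indicator)
    then show "ennreal (normal_density 0 (sqrt h) y) * (2 * emeasure (gauss v) {c - y<..}) =
      2 * (\<integral>\<^sup>+x. ennreal (normal_density 0 (sqrt v) (x - y) * normal_density 0 (sqrt h) y) * indicator {c<..} x \<partial>lborel)"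
      by (metis mult.left_commute)
  qed
  also have "\<dots> = 2 * (\<integral>\<^sup>+x. (\<integral>\<^sup>+y. ennreal (normal_density 0 (sqrt v) (x - y) * normal_density 0 (sqrt h) y) * indicator {c<..} x \<partial>lborel) \<partial>lborel)"
    by (subst nn_integral_cmult, simp, subst lborel_pair.Fubini') auto
  also have "\<dots> = 2 * (\<integral>\<^sup>+x. (\<integral>\<^sup>+y. ennreal (normal_density 0 (sqrt v) (x - y) * normal_density 0 (sqrt h) y) \<partial>lborel) * indicator {c<..} x \<partial>lborel)"
    by (subst nn_integral_multc) auto
  also have "\<dots> = 2 * emeasure (gauss (v + h)) {c<..}"
  proof -
    have "(\<integral>\<^sup>+y. ennreal (normal_density 0 (sqrt v) (x - y) * normal_density 0 (sqrt h) y) \<partial>lborel) = ennreal (normal_density 0 (sqrt (v + h)) x)" for x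
      using fun_cong[OF conv_normal_density_zero_mean[of "sqrt v" "sqrt h"], of x] v h by simp
    then show ?thesis unfolding gauss_def by (subst emeasure_density) auto
  qed
  also have "\<dots> = ennreal (gtail (v + h) c)" using v h by (simp add: ennreal_gtail)
  finally show ?thesis
    using gtail_nonneg by (subst (asm) ennreal_inj) (auto intro: integral_nonneg)
qed

lemma integral_gtail_add:
  assumes v: "0 < v" and h: "0 < h"
  shows "(\<integral>y. gtail v (c + y) \<partial>gauss h) = gtail (v + h) c"
proof -
  note [measurable] = borel_measurable_gtail[OF v]
  show ?thesis
    using integral_gauss_uminus[of "\<lambda>y. gtail v (c - y)" h] integral_gtail_diff[OF assms, of c] by simp
qed

section \<open>Random walks with their running extrema\<close>

primrec walk :: "(nat \<Rightarrow> real) \<Rightarrow> nat \<Rightarrow> real" where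
  "walk z 0 = 0"
| "walk z (Suc n) = walk z n + z n"

primrec wmax :: "(nat \<Rightarrow> real) \<Rightarrow> nat \<Rightarrow> real" where
  "wmax z 0 = 0"
| "wmax z (Suc n) = max (wmax z n) (walk z (Suc n))"

primrec wmin :: "(nat \<Rightarrow> real) \<Rightarrow> nat \<Rightarrow> real" where
  "wmin z 0 = 0"
| "wmin z (Suc n) = min (wmin z n) (walk z (Suc n))"

lemma walk_cong: "(\<And>i. i < n \<Longrightarrow> z i = z' i) \<Longrightarrow> walk z n = walk z' n"
  by (induction n) auto

lemma wmax_cong: "(\<And>i. i < n \<Longrightarrow> z i = z' i) \<Longrightarrow> wmax z n = wmax z' n"
proof (induction n)
  case (Suc n)
  then have "wmax z n = wmax z' n" "walk z (Suc n) = walk z' (Suc n)"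
    by (auto intro!: walk_cong simp del: walk.simps)
  then show ?case by (simp only: wmax.simps)
qed auto

lemma wmin_cong: "(\<And>i. i < n \<Longrightarrow> z i = z' i) \<Longrightarrow> wmin z n = wmin z' n"
proof (induction n)
  case (Suc n)
  then have "wmin z n = wmin z' n" "walk z (Suc n) = walk z' (Suc n)"
    by (auto intro!: walk_cong simp del: walk.simps)
  then show ?case by (simp only: wmin.simps)
qed auto

lemma walk_bounds: "wmin z n \<le> walk z n" "walk z n \<le> wmax z n" "wmin z n \<le> 0" "0 \<le> wmax z n"
proof -
  show "wmin z n \<le> walk z n" "walk z n \<le> wmax z n" by (cases n; simp)+
  show "wmin z n \<le> 0" by (induction n) auto
  show "0 \<le> wmax z n" by (induction n) auto
qed

lemma wmin_uminus: "wmin (\<lambda>i. - z i) n = - wmax z n"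
proof -
  have "walk (\<lambda>i. - z i) k = - walk z k" for k by (induction k) auto
  then show ?thesis by (induction n) (auto simp: max_def min_def)
qed

lemma walk_scale: "walk (\<lambda>i. c * z i) n = c * walk z n"
  by (induction n) (auto simp: algebra_simps)

lemma wmax_scale: "0 \<le> c \<Longrightarrow> wmax (\<lambda>i. c * z i) n = c * wmax z n"
  by (induction n) (auto simp: walk_scale max_mult_distrib_left distrib_left[symmetric] simp del: walk.simps simp: walk.simps(2)[symmetric])

lemma wmin_scale: "0 \<le> c \<Longrightarrow> wmin (\<lambda>i. c * z i) n = c * wmin z n"
  by (induction n) (auto simp: walk_scale min_mult_distrib_left distrib_left[symmetric] simp del: walk.simps simp: walk.simps(2)[symmetric])

lemma measurable_walk [measurable (raw)]:
  assumes "\<And>i. i < n \<Longrightarrow> (\<lambda>x. z x i) \<in> borel_measurable M"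
  shows "(\<lambda>x. walk (z x) n) \<in> borel_measurable M"
  using assms by (induction n) auto

lemma measurable_wmax [measurable (raw)]:
  assumes "\<And>i. i < n \<Longrightarrow> (\<lambda>x. z x i) \<in> borel_measurable M"
  shows "(\<lambda>x. wmax (z x) n) \<in> borel_measurable M"
  using assms
proof (induction n)
  case (Suc n)
  have "(\<lambda>x. walk (z x) (Suc n)) \<in> borel_measurable M" using Suc.prems by (rule measurable_walk)
  with Suc show ?case by (simp del: walk.simps)
qed auto

lemma measurable_wmin [measurable (raw)]:
  assumes "\<And>i. i < n \<Longrightarrow> (\<lambda>x. z x i) \<in> borel_measurable M"
  shows "(\<lambda>x. wmin (z x) n) \<in> borel_measurable M"
  using assms
proof (induction n)
  case (Suc n)
  have "(\<lambda>x. walk (z x) (Suc n)) \<in> borel_measurable M" using Suc.prems by (rule measurable_walk)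
  with Suc show ?case by (simp del: walk.simps)
qed auto

text \<open>The extrema alone are not Markov, but together with the position they are:
  \<open>wstep\<close> reads only the triple and the next increment.\<close>

definition wstate :: "(nat \<Rightarrow> real) \<Rightarrow> nat \<Rightarrow> real \<times> real \<times> real" where
  "wstate z n = (walk z n, wmax z n, wmin z n)"

definition wstep :: "real \<times> real \<times> real \<Rightarrow> real \<Rightarrow> real \<times> real \<times> real" where
  "wstep = (\<lambda>(x, s, i) y. (x + y, max s (x + y), min i (x + y)))"

lemma wstate_Suc: "wstate z (Suc n) = wstep (wstate z n) (z n)"
  by (simp add: wstate_def wstep_def)

text \<open>Applied to the past and the next step of a walk, and to the two coordinate processes of
  the planar motion.\<close>

lemma (in prob_space) distr_pair_indep_var:
  assumes iv: "indep_var S X T Y" and f[measurable]: "f \<in> S \<rightarrow>\<^sub>M S'" and g[measurable]: "g \<in> T \<rightarrow>\<^sub>M T'"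
  shows "distr M (S' \<Otimes>\<^sub>M T') (\<lambda>\<omega>. (f (X \<omega>), g (Y \<omega>))) =
     distr M S' (\<lambda>\<omega>. f (X \<omega>)) \<Otimes>\<^sub>M distr M T' (\<lambda>\<omega>. g (Y \<omega>))"
proof -
  have X[measurable]: "X \<in> M \<rightarrow>\<^sub>M S" and Y[measurable]: "Y \<in> M \<rightarrow>\<^sub>M T"
    and J: "distr M (S \<Otimes>\<^sub>M T) (\<lambda>\<omega>. (X \<omega>, Y \<omega>)) = distr M S X \<Otimes>\<^sub>M distr M T Y"
    using iv by (auto simp: indep_var_distribution_eq)
  have "distr M S' (\<lambda>\<omega>. f (X \<omega>)) \<Otimes>\<^sub>M distr M T' (\<lambda>\<omega>. g (Y \<omega>))
      = distr (distr M S X) S' f \<Otimes>\<^sub>M distr (distr M T Y) T' g"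
    by (subst (1 2) distr_distr) (auto simp: o_def)
  also have "\<dots> = distr (distr M S X \<Otimes>\<^sub>M distr M T Y) (S' \<Otimes>\<^sub>M T') (\<lambda>(x, y). (f x, g y))"
  proof (rule pair_measure_distr)
    have "prob_space (distr (distr M T Y) T' g)"
      by (intro prob_space.prob_space_distr[OF prob_space_distr]) auto
    then show "sigma_finite_measure (distr (distr M T Y) T' g)"
      by (rule prob_space_imp_sigma_finite)
  qed auto
  also have "\<dots> = distr M (S' \<Otimes>\<^sub>M T') (\<lambda>\<omega>. (f (X \<omega>), g (Y \<omega>)))"
    unfolding J[symmetric] by (subst distr_distr) (auto simp: o_def)
  finally show ?thesis by simp
qed

lemma measurable_wstate [measurable (raw)]:
  assumes "\<And>i. i < n \<Longrightarrow> (\<lambda>x. z x i) \<in> borel_measurable M"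
  shows "(\<lambda>x. wstate (z x) n) \<in> M \<rightarrow>\<^sub>M borel \<Otimes>\<^sub>M borel \<Otimes>\<^sub>M borel"
  unfolding wstate_def using assms
  by (intro measurable_Pair measurable_walk measurable_wmax measurable_wmin) auto

lemma (in prob_space) distr_wstate_pair:
  assumes ind: "indep_vars (\<lambda>_. borel) \<xi> {..<N}" and j: "j < N"
  shows "distr M ((borel \<Otimes>\<^sub>M borel \<Otimes>\<^sub>M borel) \<Otimes>\<^sub>M borel) (\<lambda>\<omega>. (wstate (\<lambda>k. \<xi> k \<omega>) j, \<xi> j \<omega>)) =
     distr M (borel \<Otimes>\<^sub>M borel \<Otimes>\<^sub>M borel) (\<lambda>\<omega>. wstate (\<lambda>k. \<xi> k \<omega>) j) \<Otimes>\<^sub>M distr M borel (\<xi> j)"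
proof -
  have iv: "indep_var (PiM {..<j} (\<lambda>_. borel)) (\<lambda>\<omega>. restrict (\<lambda>i. \<xi> i \<omega>) {..<j})
          (PiM {j} (\<lambda>_. borel)) (\<lambda>\<omega>. restrict (\<lambda>i. \<xi> i \<omega>) {j})"
    using j by (intro indep_var_restrict[OF ind]) auto
  have "(\<lambda>z. z i) \<in> borel_measurable (PiM {..<j} (\<lambda>_. borel))" if "i < j" for i
    using that by (intro measurable_component_singleton) auto
  then have f: "(\<lambda>z. wstate z j) \<in> PiM {..<j} (\<lambda>_. borel) \<rightarrow>\<^sub>M borel \<Otimes>\<^sub>M borel \<Otimes>\<^sub>M borel"
    by (intro measurable_wstate)
  have g: "(\<lambda>z. z j) \<in> borel_measurable (PiM {j} (\<lambda>_. borel))" by measurable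
  \<comment> \<open>\<open>restrict\<close> yields \<open>undefined\<close> outside the index set;
    the state at \<open>j\<close> reads only increments with index below \<open>j\<close>.\<close>
  have [simp]: "wstate (restrict (\<lambda>i. \<xi> i \<omega>) {..<j}) j = wstate (\<lambda>k. \<xi> k \<omega>) j" for \<omega>
    by (auto simp: wstate_def intro!: walk_cong wmax_cong wmin_cong)
  show ?thesis using distr_pair_indep_var[OF iv f g] by simp
qed

lemma measurable_wstep [measurable]:
  "(\<lambda>p. wstep (fst p) (snd p)) \<in> ((borel \<Otimes>\<^sub>M borel \<Otimes>\<^sub>M borel) \<Otimes>\<^sub>M borel) \<rightarrow>\<^sub>M (borel \<Otimes>\<^sub>M borel \<Otimes>\<^sub>M borel)"
  unfolding wstep_def split_beta by measurable

text \<open>\<open>F j\<close> is a value with \<open>N - j\<close> steps to go. Conditioning on the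
  state at \<open>j\<close> is Fubini for the product law of state and next step, so the error
  \<open>e\<close> accumulates linearly. The hypothesis \<open>step\<close> speaks of
  \<open>i \<le> x \<le> s\<close> because these are the states a walk can be in.\<close>

lemma (in prob_space) walk_supersolution:
  fixes F :: "nat \<Rightarrow> real \<times> real \<times> real \<Rightarrow> real"
  assumes ind: "indep_vars (\<lambda>_. borel) \<xi> {..<N}"
    and law: "\<And>j. j < N \<Longrightarrow> distr M borel (\<xi> j) = gauss h" and h: "0 < h"
    and meas: "\<And>j. F j \<in> borel_measurable (borel \<Otimes>\<^sub>M borel \<Otimes>\<^sub>M borel)"
    and bnd: "\<And>j p. \<bar>F j p\<bar> \<le> C"
    and step: "\<And>j x s i. j < N \<Longrightarrow> i \<le> x \<Longrightarrow> x \<le> s \<Longrightarrow>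
      (\<integral>y. F (Suc j) (wstep (x, s, i) y) \<partial>gauss h) \<le> F j (x, s, i) + e"
  shows "expectation (\<lambda>\<omega>. F N (wstate (\<lambda>k. \<xi> k \<omega>) N)) \<le> F 0 (0, 0, 0) + real N * e"
proof -
  have "n \<le> N \<Longrightarrow> expectation (\<lambda>\<omega>. F n (wstate (\<lambda>k. \<xi> k \<omega>) n)) \<le> F 0 (0, 0, 0) + real n * e" for n
  proof (induction n)
    case 0
    then show ?case by (simp add: wstate_def prob_space)
  next
    case (Suc j)
    let ?S = "borel \<Otimes>\<^sub>M borel \<Otimes>\<^sub>M borel :: (real \<times> real \<times> real) measure"
    let ?Z = "\<lambda>\<omega>. wstate (\<lambda>k. \<xi> k \<omega>) j"
    have X[measurable]: "\<xi> k \<in> borel_measurable M" if "k < N" for k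
      using ind that by (auto simp: indep_vars_def)
    then have Z[measurable]: "?Z \<in> M \<rightarrow>\<^sub>M ?S" and [measurable]: "\<xi> j \<in> borel_measurable M"
      using Suc.prems by (auto intro!: measurable_wstate)
    have J: "distr M (?S \<Otimes>\<^sub>M borel) (\<lambda>\<omega>. (?Z \<omega>, \<xi> j \<omega>)) = distr M ?S ?Z \<Otimes>\<^sub>M gauss h"
      using distr_wstate_pair[OF ind, of j] law[of j] Suc.prems by simp
    interpret D: prob_space "distr M ?S ?Z" by (rule prob_space_distr) simp
    interpret G: prob_space "gauss h" by (rule prob_space_gauss) fact
    interpret P: pair_prob_space "distr M ?S ?Z" "gauss h" ..
    note [measurable] = meas
    have m: "(\<lambda>p. F (Suc j) (wstep (fst p) (snd p))) \<in> borel_measurable (?S \<Otimes>\<^sub>M borel)"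
      by measurable
    then have m': "(\<lambda>p. F (Suc j) (wstep (fst p) (snd p))) \<in> borel_measurable (distr M ?S ?Z \<Otimes>\<^sub>M gauss h)"
      by (simp cong: measurable_cong_sets)
    have int: "integrable (distr M ?S ?Z \<Otimes>\<^sub>M gauss h) (\<lambda>p. F (Suc j) (wstep (fst p) (snd p)))"
      using bnd by (intro P.P.integrable_const_bound[of _ C] AE_I2 m') auto
    have "expectation (\<lambda>\<omega>. F (Suc j) (wstate (\<lambda>k. \<xi> k \<omega>) (Suc j)))
       = (\<integral>p. F (Suc j) (wstep (fst p) (snd p)) \<partial>(distr M ?S ?Z \<Otimes>\<^sub>M gauss h))"
      unfolding J[symmetric] using m by (subst integral_distr) (auto simp: wstate_Suc)
    also have "\<dots> = (\<integral>q. (\<integral>y. F (Suc j) (wstep q y) \<partial>gauss h) \<partial>distr M ?S ?Z)"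
      using P.integral_fst'[OF int] by simp
    also have "\<dots> = (\<integral>\<omega>. (\<integral>y. F (Suc j) (wstep (?Z \<omega>) y) \<partial>gauss h) \<partial>M)"
      using G.borel_measurable_lebesgue_integral[of "\<lambda>q y. F (Suc j) (wstep q y)" ?S] m
      by (subst integral_distr) (auto simp: split_beta' cong: measurable_cong_sets)
    also have "\<dots> \<le> (\<integral>\<omega>. F j (?Z \<omega>) + e \<partial>M)"
    proof (rule integral_mono)
      have "\<bar>\<integral>y. F (Suc j) (wstep q y) \<partial>gauss h\<bar> \<le> C" for q
      proof -
        have "\<bar>\<integral>y. F (Suc j) (wstep q y) \<partial>gauss h\<bar> \<le> (\<integral>y. \<bar>F (Suc j) (wstep q y)\<bar> \<partial>gauss h)"
          by (rule integral_abs_bound)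
        also have "\<dots> \<le> (\<integral>y. C \<partial>gauss h)"
          using bnd order_trans[OF abs_ge_zero bnd[of 0 "(0,0,0)"]]
          by (intro integral_mono') auto
        finally show ?thesis using G.prob_space by simp
      qed
      then show "integrable M (\<lambda>\<omega>. \<integral>y. F (Suc j) (wstep (?Z \<omega>) y) \<partial>gauss h)"
        using G.borel_measurable_lebesgue_integral[of "\<lambda>q y. F (Suc j) (wstep q y)" ?S] m
        by (intro integrable_const_bound[of _ C])
          (auto intro!: measurable_compose[OF Z] simp: split_beta' cong: measurable_cong_sets)
      have "integrable M (\<lambda>\<omega>. F j (?Z \<omega>))"
        using bnd by (intro integrable_const_bound[of _ C]) auto
      then show "integrable M (\<lambda>\<omega>. F j (?Z \<omega>) + e)" by simp
      show "(\<integral>y. F (Suc j) (wstep (?Z \<omega>) y) \<partial>gauss h) \<le> F j (?Z \<omega>) + e" for \<omega>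
        unfolding wstate_def using Suc.prems walk_bounds by (intro step) auto
    qed
    also have "\<dots> = expectation (\<lambda>\<omega>. F j (?Z \<omega>)) + e"
    proof -
      have "integrable M (\<lambda>\<omega>. F j (?Z \<omega>))"
        using bnd by (intro integrable_const_bound[of _ C]) auto
      then show ?thesis by (simp add: prob_space)
    qed
    also have "\<dots> \<le> F 0 (0, 0, 0) + real (Suc j) * e" using Suc by (simp add: algebra_simps)
    finally show ?case .
  qed
  then show ?thesis by simp
qed

section \<open>Passing two levels: the truncated reflection series\<close>

text \<open>\<open>altsum t m\<close> is the sum of \<open>(-1) ^ k * t k\<close> over \<open>2 \<le> k \<le> 2 * m + 2\<close>.\<close>

primrec altsum :: "(nat \<Rightarrow> real) \<Rightarrow> nat \<Rightarrow> real" where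
  "altsum t 0 = t 2"
| "altsum t (Suc m) = altsum t m - t (2 * m + 3) + t (2 * m + 4)"

text \<open>Leibniz: adding \<open>- t (2 * m + 3) + t (2 * m + 4)\<close> to a sum that is at least
  \<open>t (2 * m + 2)\<close>, hence at least \<open>t (2 * m + 3)\<close>, leaves at least
  \<open>t (2 * m + 4)\<close>. Nonnegativity of \<open>hit_bound\<close> rests on this.\<close>

lemma altsum_ge:
  assumes "\<And>k. t (Suc k) \<le> t k"
  shows "t (2 * m + 2) \<le> altsum t m"
proof (induction m)
  case (Suc m)
  have "t (2 * m + 3) \<le> t (2 * m + 2)"
    using assms[of "2 * m + 2"] by (simp add: numeral_eq_Suc)
  with Suc show ?case by (simp add: numeral_eq_Suc)
next
  case 0
  then show ?case by (simp add: numeral_2_eq_2)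
qed

lemma altsum_abs_le:
  assumes "\<And>k. \<bar>t k\<bar> \<le> c"
  shows "\<bar>altsum t m\<bar> \<le> c + 2 * real m * c"
proof (induction m)
  case (Suc m)
  have "\<bar>t (2 * m + 3)\<bar> \<le> c" "\<bar>t (2 * m + 4)\<bar> \<le> c" using assms by auto
  with Suc show ?case by (simp add: algebra_simps abs_le_iff)
qed (simp add: assms)

text \<open>Stopping at an even index leaves the boundary term with a plus sign, so for nonnegative
  \<open>f\<close> the sum stays above \<open>f 1\<close>.\<close>

lemma altsum_telescope: "altsum (\<lambda>k. f (k - 1) + f k) m = f 1 + f (2 * m + 2)"
  by (induction m) (simp_all add: numeral_eq_Suc)

text \<open>Even terms use the first assumption, the \<open>m\<close> odd ones the second. Index 0
  is excluded because the telescoping terms contain \<open>k - 1\<close> in the naturals.\<close>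

lemma altsum_mono:
  assumes "\<And>k. 0 < k \<Longrightarrow> t' k \<le> t k" "\<And>k. 0 < k \<Longrightarrow> t k \<le> t' k + e"
  shows "altsum t' m - real m * e \<le> altsum t m"
proof (induction m)
  case 0
  then show ?case using assms(1)[of 2] by simp
next
  case (Suc m)
  then show ?case using assms(2)[of "2 * m + 3"] assms(1)[of "2 * m + 4"] by (simp add: algebra_simps)
qed

lemma has_bochner_integral_altsum:
  assumes "\<And>k. 2 \<le> k \<Longrightarrow> has_bochner_integral M (f k) (c k)"
  shows "has_bochner_integral M (\<lambda>x. altsum (\<lambda>k. f k x) m) (altsum c m)"
proof (induction m)
  case (Suc m)
  then show ?case
    unfolding altsum.simps
    by (intro has_bochner_integral_add has_bochner_integral_diff assms) auto
qed (simp add: assms)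

text \<open>For \<open>x\<close> between \<open>-b\<close> and \<open>a\<close>, the two summands of \<open>alt_term v a b x k\<close> are the probabilities that Brownian
  motion from \<open>x\<close> visits \<open>a\<close> and \<open>-b\<close> alternately \<open>k\<close> times before time \<open>v\<close>, beginning with \<open>a\<close> or with \<open>-b\<close>:
  reflecting at each visit turns this into passing a single level. If \<open>K \<ge> 2\<close> alternating visits occur, their
  alternating sum over \<open>k \<ge> 2\<close> is exactly \<open>1\<close>.\<close>

definition alt_term :: "real \<Rightarrow> real \<Rightarrow> real \<Rightarrow> real \<Rightarrow> nat \<Rightarrow> real" where
  "alt_term v a b x k = gtail v (real k * a + (real k - 1) * b - x) + gtail v ((real k - 1) * a + real k * b + x)"

definition hit_bound :: "real \<Rightarrow> real \<Rightarrow> real \<Rightarrow> nat \<Rightarrow> real \<Rightarrow> real" where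
  "hit_bound v a b m x = altsum (alt_term v a b x) m"

lemma alt_term_bounds: "0 < v \<Longrightarrow> 0 \<le> alt_term v a b x k" "0 < v \<Longrightarrow> alt_term v a b x k \<le> 4"
  using gtail_le_2 add_mono[OF gtail_le_2 gtail_le_2] by (fastforce simp: alt_term_def gtail_nonneg)+

lemma alt_term_antimono:
  assumes "0 < v" "0 \<le> a" "0 \<le> b"
  shows "alt_term v a b x (Suc k) \<le> alt_term v a b x k"
  unfolding alt_term_def using assms by (intro add_mono gtail_antimono) (auto simp: algebra_simps)

lemma hit_bound_nonneg: "0 < v \<Longrightarrow> 0 \<le> a \<Longrightarrow> 0 \<le> b \<Longrightarrow> 0 \<le> hit_bound v a b m x"
  unfolding hit_bound_def
  by (rule order_trans[OF alt_term_bounds(1) altsum_ge]) (auto intro: alt_term_antimono)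

lemma hit_bound_abs_le: "0 < v \<Longrightarrow> \<bar>hit_bound v a b m x\<bar> \<le> 4 + 8 * real m"
  unfolding hit_bound_def using altsum_abs_le[of "alt_term v a b x" 4 m] alt_term_bounds[of v a b x]
  by (auto simp: abs_of_nonneg)

text \<open>Reflection at 0 exchanges the two levels; it reduces the passage of \<open>- b\<close>
  to that of \<open>a\<close>.\<close>

lemma hit_bound_swap: "hit_bound v a b m x = hit_bound v b a m (- x)"
  unfolding hit_bound_def alt_term_def by (simp add: algebra_simps)

text \<open>At \<open>z = 0\<close> the reflection symmetry makes the alternating sum telescope, so there the bound dominates the
  one-level tail; the Lipschitz constant of the tail controls an overshoot by \<open>z\<close>.\<close>

lemma hit_bound_beyond:
  assumes d: "0 < d" "d \<le> v" and a: "0 \<le> a" "0 \<le> b" and z: "0 \<le> z"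
  shows "gtail v (b + (a + z)) \<le> hit_bound v a b m (a + z) + real m * (2 * z / sqrt d)"
proof -
  have v: "0 < v" using d by simp
  define f where "f = (\<lambda>k. gtail v (real k * (a + b) + z))"
  define t' where "t' = (\<lambda>k. f (k - 1) + f k)"
  \<comment> \<open>At \<open>a + z\<close> the second summand is exactly \<open>f k\<close>, while
    the first misses \<open>f (k - 1)\<close> by a shift of \<open>2 * z\<close> in its
    argument.\<close>
  have t: "alt_term v a b (a + z) k = gtail v ((real k - 1) * (a + b) - z) + f k" for k
  proof -
    have "real k * a + (real k - 1) * b - (a + z) = (real k - 1) * (a + b) - z"
      "(real k - 1) * a + real k * b + (a + z) = real k * (a + b) + z" by (simp_all add: algebra_simps)
    then show ?thesis by (simp only: alt_term_def f_def)
  qed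
  have t': "t' k = gtail v ((real k - 1) * (a + b) + z) + f k" if "0 < k" for k
    using that by (simp add: t'_def f_def of_nat_diff)
  have "altsum t' m - real m * (2 * z / sqrt d) \<le> altsum (alt_term v a b (a + z)) m"
  proof (rule altsum_mono)
    fix k :: nat assume "0 < k"
    then show "t' k \<le> alt_term v a b (a + z) k"
      unfolding t t'[OF \<open>0 < k\<close>] using z by (intro add_mono gtail_antimono v) auto
    show "alt_term v a b (a + z) k \<le> t' k + 2 * z / sqrt d"
      unfolding t t'[OF \<open>0 < k\<close>]
      using gtail_lipschitz[OF d, of "(real k - 1) * (a + b) - z" "(real k - 1) * (a + b) + z"] z by simp
  qed
  moreover have "altsum t' m = f 1 + f (2 * m + 2)" unfolding t'_def by (rule altsum_telescope)
  moreover have "f 1 = gtail v (b + (a + z))" by (simp add: f_def algebra_simps)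
  moreover have "0 \<le> f (2 * m + 2)" by (simp add: f_def gtail_nonneg)
  ultimately show ?thesis by (simp add: hit_bound_def)
qed

lemma borel_measurable_hit_bound:
  assumes v: "0 < v"
  shows "hit_bound v a b m \<in> borel_measurable borel"
proof -
  note [measurable] = borel_measurable_gtail[OF v]
  have [measurable]: "(\<lambda>x. alt_term v a b x k) \<in> borel_measurable borel" for k
    unfolding alt_term_def by measurable
  have "(\<lambda>x. altsum (alt_term v a b x) m) \<in> borel_measurable borel" by (induction m) auto
  then show ?thesis by (simp add: hit_bound_def[abs_def])
qed

lemma has_bochner_integral_gtail:
  assumes "0 < v" "0 < h"
  shows "has_bochner_integral (gauss h) (\<lambda>y. gtail v (c - (x + y))) (gtail (v + h) (c - x))"
    and "has_bochner_integral (gauss h) (\<lambda>y. gtail v (c + (x + y))) (gtail (v + h) (c + x))"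
proof -
  note [measurable] = borel_measurable_gtail[OF assms(1)]
  have "integrable (gauss h) (\<lambda>y. gtail v (c - (x + y)))" "integrable (gauss h) (\<lambda>y. gtail v (c + (x + y)))"
    using gtail_nonneg gtail_le_2[OF assms(1)]
    by (intro integrable_gauss_bounded[OF assms(2), of _ 2]; auto)+
  then show "has_bochner_integral (gauss h) (\<lambda>y. gtail v (c - (x + y))) (gtail (v + h) (c - x))"
    "has_bochner_integral (gauss h) (\<lambda>y. gtail v (c + (x + y))) (gtail (v + h) (c + x))"
    using integral_gtail_diff[OF assms, of "c - x"] integral_gtail_add[OF assms, of "c + x"]
    by (auto simp: has_bochner_integral_iff algebra_simps)
qed

lemma has_bochner_integral_hit_bound:
  assumes "0 < v" "0 < h"
  shows "has_bochner_integral (gauss h) (\<lambda>y. hit_bound v a b m (x + y)) (hit_bound (v + h) a b m x)"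
  unfolding hit_bound_def alt_term_def
  by (intro has_bochner_integral_altsum has_bochner_integral_add has_bochner_integral_gtail assms)

text \<open>The remaining probability of passing both levels when \<open>x\<close>, \<open>s\<close>, \<open>i\<close> are the current value, maximum and minimum;
  \<open>\<kappa>\<close> pays once for the overshoot at the first passage.\<close>

definition hit_value :: "real \<Rightarrow> real \<Rightarrow> nat \<Rightarrow> real \<Rightarrow> real \<Rightarrow> real \<times> real \<times> real \<Rightarrow> real" where
  "hit_value a b m \<kappa> v = (\<lambda>(x, s, i).
     if a < s \<and> i < - b then 1 else if a < s then gtail v (b + x)
     else if i < - b then gtail v (a - x) else hit_bound v a b m x + \<kappa>)"

text \<open>\<open>\<psi>\<close> freezes the branch of \<open>hit_value\<close> chosen by the
  current extrema and is averaged exactly; only steps that switch the branch need a comparison. With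
  one level outstanding, the switch goes from a tail \<ge> 1 to the value 1. With none passed, a
  short overshoot is covered by \<open>hit_bound_beyond\<close> and \<open>\<kappa>\<close>, and a
  jump longer than \<open>e\<close> by the penalty \<open>q\<close>.\<close>

lemma hit_value_step:
  assumes d: "0 < d" "d \<le> v" and h: "0 < h" and ab: "0 \<le> a" "0 \<le> b" and e: "0 < e"
    and \<kappa>: "\<kappa> = real m * (2 * e / sqrt d)" and x: "i \<le> x" "x \<le> s"
  shows "(\<integral>y. hit_value a b m \<kappa> v (wstep (x, s, i) y) \<partial>gauss h)
     \<le> hit_value a b m \<kappa> (v + h) (x, s, i) + 6 * h\<^sup>2 / e ^ 4"
proof -
  have v: "0 < v" using d by simp
  interpret G: prob_space "gauss h" by (rule prob_space_gauss) fact
  note [measurable] = borel_measurable_gtail[OF v] borel_measurable_hit_bound[OF v]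
  have "0 \<le> \<kappa>" using \<kappa> e d by simp
  \<comment> \<open>As soon as |y| > e, \<open>q\<close> is at least 2, the bound for every tail;
    its mean is (2 / e^4) * 3 h^2, the error term of the lemma.\<close>
  define q where "q = (\<lambda>y. 2 / e ^ 4 * y ^ 4)"
  have q0: "0 \<le> q y" for y using e by (simp add: q_def)
  have q2: "2 \<le> q y" if "e < \<bar>y\<bar>" for y
  proof -
    have "e ^ 4 \<le> \<bar>y\<bar> ^ 4" using that e by (intro power_mono) auto
    then show ?thesis using e by (simp add: q_def field_simps)
  qed
  have qi: "has_bochner_integral (gauss h) q (6 * h\<^sup>2 / e ^ 4)"
    unfolding q_def using has_bochner_integral_mult_right[OF gauss_moment(2)[OF h], of "2 / e ^ 4"]
    by simp
  define \<psi> where "\<psi> = (\<lambda>w x. if a < s \<and> i < - b then 1 else if a < s then gtail w (b + x)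
     else if i < - b then gtail w (a - x) else hit_bound w a b m x + \<kappa>)"
  have psi: "has_bochner_integral (gauss h) (\<lambda>y. \<psi> v (x + y)) (\<psi> (v + h) x)"
  proof -
    have 1: "has_bochner_integral (gauss h) (\<lambda>y. c) c" for c :: real
      using G.prob_space by (simp add: has_bochner_integral_iff)
    show ?thesis
      unfolding \<psi>_def
      using has_bochner_integral_gtail[OF v h, of a x] has_bochner_integral_gtail[OF v h, of b x]
        has_bochner_integral_add[OF has_bochner_integral_hit_bound[OF v h] 1] 1
      by auto
  qed
  have pw: "hit_value a b m \<kappa> v (wstep (x, s, i) y) \<le> \<psi> v (x + y) + q y" for y
  proof -
    consider "a < s" "i < - b" | "a < s" "\<not> i < - b" | "\<not> a < s" "i < - b" | "\<not> a < s" "\<not> i < - b" by blast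
    then show ?thesis
    proof cases
      case 1
      then show ?thesis using q0 by (auto simp: hit_value_def wstep_def \<psi>_def)
    next
      case 2
      then show ?thesis using q0[of y] gtail_nonpos[OF v, of "b + (x + y)"]
        by (auto simp: hit_value_def wstep_def \<psi>_def min_def split: if_splits)
    next
      case 3
      then show ?thesis using q0[of y] gtail_nonpos[OF v, of "a - (x + y)"]
        by (auto simp: hit_value_def wstep_def \<psi>_def max_def split: if_splits)
    next
      case 4
      have far: "g \<le> hit_bound v a b m (x + y) + \<kappa> + q y" if "e < \<bar>y\<bar>" "g \<le> 2" for g
        using q2[OF that(1)] that(2) hit_bound_nonneg[OF v ab, of m "x + y"] \<open>0 \<le> \<kappa>\<close> by simp
      consider "a < x + y" | "x + y < - b" | "x + y \<le> a" "- b \<le> x + y" by linarith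
      then show ?thesis
      proof cases
        case A: 1
        have "gtail v (b + (x + y)) \<le> hit_bound v a b m (x + y) + \<kappa> + q y"
        proof (cases "e < \<bar>y\<bar>")
          case True
          then show ?thesis using far gtail_le_2[OF v] by blast
        next
          case False
          define z where "z = x + y - a"
          \<comment> \<open>Since \<open>x \<le> s\<close> and \<open>s \<le> a\<close>, the
            overshoot is at most the step \<open>y\<close>, hence at most \<open>e\<close>.\<close>
          have z: "0 \<le> z" "z \<le> e" using A 4 x False by (auto simp: z_def)
          have "real m * (2 * z / sqrt d) \<le> \<kappa>" unfolding \<kappa> using z d
            by (intro mult_left_mono divide_right_mono) auto
          moreover have "x + y = a + z" by (simp add: z_def)
          ultimately show ?thesis using hit_bound_beyond[OF d ab z(1), of m] q0[of y] by simp
        qed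
        moreover have "\<not> x + y < - b" using A ab by linarith
        ultimately show ?thesis using 4 A by (auto simp: hit_value_def wstep_def \<psi>_def)
      next
        case B: 2
        have "gtail v (a - (x + y)) \<le> hit_bound v a b m (x + y) + \<kappa> + q y"
        proof (cases "e < \<bar>y\<bar>")
          case True
          then show ?thesis using far gtail_le_2[OF v] by blast
        next
          case False
          define z where "z = - b - (x + y)"
          have z: "0 \<le> z" "z \<le> e" using B 4 x False by (auto simp: z_def)
          have "real m * (2 * z / sqrt d) \<le> \<kappa>" unfolding \<kappa> using z d
            by (intro mult_left_mono divide_right_mono) auto
          moreover have "hit_bound v a b m (x + y) = hit_bound v b a m (b + z)"
            by (subst hit_bound_swap) (simp add: z_def)
          moreover have "gtail v (a - (x + y)) = gtail v (a + (b + z))"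
            by (rule arg_cong[where f="gtail v"]) (simp add: z_def)
          ultimately show ?thesis
            using hit_bound_beyond[OF d ab(2,1) z(1), of m] q0[of y] by linarith
        qed
        moreover have "\<not> a < x + y" using B ab by linarith
        ultimately show ?thesis using 4 B by (auto simp: hit_value_def wstep_def \<psi>_def)
      next
        case 3
        then show ?thesis using 4 q0[of y] by (auto simp: hit_value_def wstep_def \<psi>_def)
      qed
    qed
  qed
  have "(\<integral>y. hit_value a b m \<kappa> v (wstep (x, s, i) y) \<partial>gauss h) \<le> (\<integral>y. \<psi> v (x + y) + q y \<partial>gauss h)"
  proof (rule integral_mono')
    show "integrable (gauss h) (\<lambda>y. \<psi> v (x + y) + q y)" using psi qi by (auto simp: has_bochner_integral_iff)
    show "0 \<le> \<psi> v (x + y) + q y" for y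
      using q0[of y] hit_bound_nonneg[OF v ab] gtail_nonneg \<open>0 \<le> \<kappa>\<close> by (auto simp: \<psi>_def intro!: add_nonneg_nonneg)
  qed (rule pw)
  also have "\<dots> = \<psi> (v + h) x + 6 * h\<^sup>2 / e ^ 4"
    using has_bochner_integral_add[OF psi qi] by (rule has_bochner_integral_integral_eq)
  also have "\<psi> (v + h) x = hit_value a b m \<kappa> (v + h) (x, s, i)" by (simp add: \<psi>_def hit_value_def)
  finally show ?thesis .
qed

lemma distr_gauss_uminus: "distr (gauss v) borel uminus = gauss v"
proof (rule measure_eqI)
  fix A assume "A \<in> sets (distr (gauss v) borel uminus)"
  then have [measurable]: "A \<in> sets borel" by simp
  have "emeasure (distr (gauss v) borel uminus) A = (\<integral>\<^sup>+x. indicator A x \<partial>distr (gauss v) borel uminus)"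
    by simp
  also have "\<dots> = (\<integral>\<^sup>+x. indicator A (- x) \<partial>gauss v)"
    by (subst nn_integral_distr) auto
  also have "\<dots> = emeasure (gauss v) A" by (subst nn_integral_gauss_uminus) auto
  finally show "emeasure (distr (gauss v) borel uminus) A = emeasure (gauss v) A" .
qed simp

section \<open>Gaussian walks: the probability of passing two levels or one\<close>

context prob_space
begin

text \<open>After \<open>j\<close> steps the remaining horizon is d + (N - j) h, so all tails keep
  variance at least \<open>d\<close> and one Lipschitz constant serves throughout. At time
  \<open>N\<close> the value is 1 on the event and nonnegative elsewhere.\<close>

lemma prob_walk_hits_both:
  assumes ind: "indep_vars (\<lambda>_. borel) \<xi> {..<N}"
    and law: "\<And>j. j < N \<Longrightarrow> distr M borel (\<xi> j) = gauss h" and h: "0 < h"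
    and d: "0 < d" and ab: "0 \<le> a" "0 \<le> b" and e: "0 < e"
  shows "prob {\<omega>\<in>space M. a < wmax (\<lambda>k. \<xi> k \<omega>) N \<and> wmin (\<lambda>k. \<xi> k \<omega>) N < - b}
    \<le> hit_bound (d + real N * h) a b m 0 + real m * (2 * e / sqrt d) + real N * (6 * h\<^sup>2 / e ^ 4)"
proof -
  define \<kappa> where "\<kappa> = real m * (2 * e / sqrt d)"
  have k0: "0 \<le> \<kappa>" using e d by (simp add: \<kappa>_def)
  define v where "v = (\<lambda>j. d + real (N - j) * h)"
  have v: "d \<le> v j" "0 < v j" for j using d h by (auto simp: v_def add_pos_nonneg)
  define F where "F = (\<lambda>j. hit_value a b m \<kappa> (v j))"
  have [measurable]: "\<xi> j \<in> borel_measurable M" if "j < N" for j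
    using ind that by (auto simp: indep_vars_def)
  have [measurable]: "(\<lambda>\<omega>. wstate (\<lambda>k. \<xi> k \<omega>) N) \<in> M \<rightarrow>\<^sub>M borel \<Otimes>\<^sub>M borel \<Otimes>\<^sub>M borel"
    "(\<lambda>\<omega>. wmax (\<lambda>k. \<xi> k \<omega>) N) \<in> borel_measurable M" "(\<lambda>\<omega>. wmin (\<lambda>k. \<xi> k \<omega>) N) \<in> borel_measurable M"
    by (intro measurable_wstate measurable_wmax measurable_wmin; simp)+
  have Fm[measurable]: "F j \<in> borel_measurable (borel \<Otimes>\<^sub>M borel \<Otimes>\<^sub>M borel)" for j
  proof -
    note [measurable] = borel_measurable_gtail[OF v(2)] borel_measurable_hit_bound[OF v(2)]
    show ?thesis unfolding F_def hit_value_def split_beta' by measurable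
  qed
  have Fb: "\<bar>F j p\<bar> \<le> 4 + 8 * real m + \<kappa>" for j p
    using gtail_le_2[OF v(2)] gtail_nonneg hit_bound_abs_le[OF v(2)] k0
    by (auto simp: F_def hit_value_def split_beta' abs_of_nonneg intro!: order_trans[OF gtail_le_2[OF v(2)]] order_trans[OF abs_triangle_ineq] add_mono)
  have F0: "0 \<le> F j p" for j p
    using gtail_nonneg hit_bound_nonneg[OF v(2) ab] k0 by (auto simp: F_def hit_value_def split_beta')
  have "prob {\<omega>\<in>space M. a < wmax (\<lambda>k. \<xi> k \<omega>) N \<and> wmin (\<lambda>k. \<xi> k \<omega>) N < - b}
     = expectation (indicator {\<omega>\<in>space M. a < wmax (\<lambda>k. \<xi> k \<omega>) N \<and> wmin (\<lambda>k. \<xi> k \<omega>) N < - b})"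
    by simp
  also have "\<dots> \<le> expectation (\<lambda>\<omega>. F N (wstate (\<lambda>k. \<xi> k \<omega>) N))"
  proof (rule integral_mono')
    show "integrable M (\<lambda>\<omega>. F N (wstate (\<lambda>k. \<xi> k \<omega>) N))"
      using Fb by (intro integrable_const_bound[of _ "4 + 8 * real m + \<kappa>"]) auto
    show "0 \<le> F N (wstate (\<lambda>k. \<xi> k \<omega>) N)" for \<omega> by (rule F0)
    show "indicator {\<omega>\<in>space M. a < wmax (\<lambda>k. \<xi> k \<omega>) N \<and> wmin (\<lambda>k. \<xi> k \<omega>) N < - b} \<omega>
        \<le> F N (wstate (\<lambda>k. \<xi> k \<omega>) N)" for \<omega>
    proof (cases "a < wmax (\<lambda>k. \<xi> k \<omega>) N \<and> wmin (\<lambda>k. \<xi> k \<omega>) N < - b")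
      case True
      then show ?thesis by (simp add: F_def hit_value_def wstate_def indicator_def)
    next
      case False
      then show ?thesis using F0 by auto
    qed
  qed
  also have "\<dots> \<le> F 0 (0, 0, 0) + real N * (6 * h\<^sup>2 / e ^ 4)"
  proof (rule walk_supersolution[OF ind law h Fm Fb])
    fix j x s i assume j: "j < N" and x: "(i::real) \<le> x" "x \<le> s"
    have "v j = v (Suc j) + h" using j by (simp add: v_def of_nat_diff algebra_simps)
    then show "(\<integral>y. F (Suc j) (wstep (x, s, i) y) \<partial>gauss h) \<le> F j (x, s, i) + 6 * h\<^sup>2 / e ^ 4"
      unfolding F_def using hit_value_step[OF d v(1) h ab e \<kappa>_def x, of "Suc j"] by simp
  qed
  also have "F 0 (0, 0, 0) = hit_bound (d + real N * h) a b m 0 + \<kappa>"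
    using ab by (auto simp: F_def hit_value_def v_def)
  finally show ?thesis by (simp add: \<kappa>_def)
qed

text \<open>A jump over a single level meets a tail that is at least 1, so the overshoot costs
  nothing and the error per step is 0.\<close>

lemma prob_wmax_le:
  assumes ind: "indep_vars (\<lambda>_. borel) \<xi> {..<N}"
    and law: "\<And>j. j < N \<Longrightarrow> distr M borel (\<xi> j) = gauss h" and h: "0 < h"
    and d: "0 < d" and a: "0 \<le> a"
  shows "prob {\<omega>\<in>space M. a < wmax (\<lambda>k. \<xi> k \<omega>) N} \<le> gtail (d + real N * h) a"
proof -
  interpret G: prob_space "gauss h" by (rule prob_space_gauss) fact
  define v where "v = (\<lambda>j. d + real (N - j) * h)"
  have v: "0 < v j" for j using d h by (auto simp: v_def add_pos_nonneg)
  define F :: "nat \<Rightarrow> real \<times> real \<times> real \<Rightarrow> real"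
    where "F = (\<lambda>j (x, s, i). if a < s then 1 else gtail (v j) (a - x))"
  have [measurable]: "\<xi> j \<in> borel_measurable M" if "j < N" for j
    using ind that by (auto simp: indep_vars_def)
  have [measurable]: "(\<lambda>\<omega>. wstate (\<lambda>k. \<xi> k \<omega>) N) \<in> M \<rightarrow>\<^sub>M borel \<Otimes>\<^sub>M borel \<Otimes>\<^sub>M borel"
    "(\<lambda>\<omega>. wmax (\<lambda>k. \<xi> k \<omega>) N) \<in> borel_measurable M"
    by (intro measurable_wstate measurable_wmax; simp)+
  have Fm[measurable]: "F j \<in> borel_measurable (borel \<Otimes>\<^sub>M borel \<Otimes>\<^sub>M borel)" for j
  proof -
    note [measurable] = borel_measurable_gtail[OF v]
    show ?thesis unfolding F_def split_beta' by measurable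
  qed
  have Fb: "\<bar>F j p\<bar> \<le> 2" and F0: "0 \<le> F j p" for j p
    using gtail_le_2[OF v] gtail_nonneg by (auto simp: F_def split_beta')
  have "prob {\<omega>\<in>space M. a < wmax (\<lambda>k. \<xi> k \<omega>) N}
     = expectation (indicator {\<omega>\<in>space M. a < wmax (\<lambda>k. \<xi> k \<omega>) N})"
    by simp
  also have "\<dots> \<le> expectation (\<lambda>\<omega>. F N (wstate (\<lambda>k. \<xi> k \<omega>) N))"
  proof (rule integral_mono')
    show "integrable M (\<lambda>\<omega>. F N (wstate (\<lambda>k. \<xi> k \<omega>) N))"
      using Fb by (intro integrable_const_bound[of _ 2]) auto
    show "0 \<le> F N (wstate (\<lambda>k. \<xi> k \<omega>) N)" for \<omega> by (rule F0)
    show "indicator {\<omega>\<in>space M. a < wmax (\<lambda>k. \<xi> k \<omega>) N} \<omega> \<le> F N (wstate (\<lambda>k. \<xi> k \<omega>) N)" for \<omega>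
    proof (cases "a < wmax (\<lambda>k. \<xi> k \<omega>) N")
      case True
      then show ?thesis by (simp add: F_def wstate_def indicator_def)
    next
      case False
      then show ?thesis using F0 by auto
    qed
  qed
  also have "\<dots> \<le> F 0 (0, 0, 0) + real N * 0"
  proof (rule walk_supersolution[OF ind law h Fm Fb])
    fix j x s i assume j: "j < N" and x: "(i::real) \<le> x" "x \<le> s"
    have vj: "v j = v (Suc j) + h" using j by (simp add: v_def of_nat_diff algebra_simps)
    note g = has_bochner_integral_gtail(1)[OF v h, of "Suc j" a x, folded vj]
    show "(\<integral>y. F (Suc j) (wstep (x, s, i) y) \<partial>gauss h) \<le> F j (x, s, i) + 0"
    proof (cases "a < s")
      case True
      then show ?thesis using G.prob_space by (simp add: F_def wstep_def less_max_iff_disj)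
    next
      case False
      have "(\<integral>y. F (Suc j) (wstep (x, s, i) y) \<partial>gauss h) \<le> (\<integral>y. gtail (v (Suc j)) (a - (x + y)) \<partial>gauss h)"
      proof (rule integral_mono')
        show "integrable (gauss h) (\<lambda>y. gtail (v (Suc j)) (a - (x + y)))"
          using g by (simp add: has_bochner_integral_iff)
        show "F (Suc j) (wstep (x, s, i) y) \<le> gtail (v (Suc j)) (a - (x + y))" for y
          using False gtail_nonpos[OF v, of "a - (x + y)"] by (auto simp: F_def wstep_def max_def)
      qed (rule gtail_nonneg)
      also have "\<dots> = gtail (v j) (a - x)" using g by (rule has_bochner_integral_integral_eq)
      finally show ?thesis using False by (simp add: F_def)
    qed
  qed
  also have "F 0 (0, 0, 0) = gtail (d + real N * h) a"
    using a by (auto simp: F_def v_def)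
  finally show ?thesis by simp
qed

lemma prob_wmin_le:
  assumes ind: "indep_vars (\<lambda>_. borel) \<xi> {..<N}"
    and law: "\<And>j. j < N \<Longrightarrow> distr M borel (\<xi> j) = gauss h" and h: "0 < h"
    and d: "0 < d" and a: "0 \<le> a"
  shows "prob {\<omega>\<in>space M. a < - wmin (\<lambda>k. \<xi> k \<omega>) N} \<le> gtail (d + real N * h) a"
proof -
  have "prob {\<omega>\<in>space M. a < wmax (\<lambda>k. - \<xi> k \<omega>) N} \<le> gtail (d + real N * h) a"
  proof (rule prob_wmax_le[OF _ _ h d a])
    show "indep_vars (\<lambda>_. borel) (\<lambda>k \<omega>. - \<xi> k \<omega>) {..<N}"
      by (rule indep_vars_compose2[OF ind]) auto
    show "distr M borel (\<lambda>\<omega>. - \<xi> j \<omega>) = gauss h" if "j < N" for j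
    proof -
      have [measurable]: "\<xi> j \<in> borel_measurable M"
        using ind that by (auto simp: indep_vars_def)
      have "distr M borel (\<lambda>\<omega>. - \<xi> j \<omega>) = distr (distr M borel (\<xi> j)) borel uminus"
        by (subst distr_distr) (auto simp: o_def)
      also have "\<dots> = gauss h" by (simp add: law[OF that] distr_gauss_uminus)
      finally show ?thesis .
    qed
  qed
  moreover have "wmax (\<lambda>k. - z k) N = - wmin z N" for z
    using wmin_uminus[of "\<lambda>k. - z k" N] by simp
  ultimately show ?thesis by simp
qed

end

section \<open>Second moment of the range\<close>

lemma emeasure_triangle:
  fixes \<alpha> \<beta> v :: real
  assumes "0 < \<alpha>" "0 < \<beta>" "0 \<le> v"
  shows "emeasure (lborel \<Otimes>\<^sub>M lborel) {(a, b). 0 < a \<and> 0 < b \<and> \<alpha> * a + \<beta> * b < v} = ennreal (v\<^sup>2 / (2 * \<alpha> * \<beta>))"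
proof -
  let ?A = "{(a, b). 0 < a \<and> 0 < b \<and> \<alpha> * a + \<beta> * b < v}"
  have [measurable]: "?A \<in> sets (lborel \<Otimes>\<^sub>M lborel)"
  proof -
    have "?A = {p\<in>space (borel \<Otimes>\<^sub>M borel). 0 < fst p \<and> 0 < snd p \<and> \<alpha> * fst p + \<beta> * snd p < v}"
      by (auto simp: space_pair_measure)
    also have "\<dots> \<in> sets (borel \<Otimes>\<^sub>M borel)" by measurable
    finally show ?thesis by (simp cong: sets_pair_measure_cong)
  qed
  have "emeasure (lborel \<Otimes>\<^sub>M lborel) ?A = (\<integral>\<^sup>+a. emeasure lborel (Pair a -` ?A) \<partial>lborel)"
    by (rule lborel.emeasure_pair_measure_alt) measurable
  also have "\<dots> = (\<integral>\<^sup>+a. ennreal ((v - \<alpha> * a) / \<beta>) * indicator {0..v / \<alpha>} a \<partial>lborel)"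
  \<comment> \<open>At \<open>a = 0\<close> the open triangle has an empty section, while the closed
    interval of integration contains the point.\<close>
  proof (rule nn_integral_cong_AE, use AE_lborel_singleton[of 0] in eventually_elim)
    fix a :: real assume a: "a \<noteq> 0"
    have eq: "Pair a -` ?A = (if 0 < a then {0<..<(v - \<alpha> * a) / \<beta>} else {})"
      using assms by (auto simp: field_simps)
    show "emeasure lborel (Pair a -` ?A) = ennreal ((v - \<alpha> * a) / \<beta>) * indicator {0..v / \<alpha>} a"
    proof (cases "0 < a \<and> a \<le> v / \<alpha>")
      case True
      then have "\<alpha> * a \<le> v" using assms by (simp add: field_simps)
      then show ?thesis unfolding eq using True assms by simp
    next
      case False
      then have "v < \<alpha> * a" if "0 < a" using assms that by (simp add: field_simps)
      then have "(v - \<alpha> * a) / \<beta> < 0" if "0 < a" using assms that by (simp add: divide_neg_pos)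
      then show ?thesis unfolding eq using False a by (auto simp: indicator_def)
    qed
  qed
  also have "\<dots> = ennreal ((\<lambda>a. (v * a - \<alpha> * a\<^sup>2 / 2) / \<beta>) (v / \<alpha>) - (\<lambda>a. (v * a - \<alpha> * a\<^sup>2 / 2) / \<beta>) 0)"
    using assms
  proof (intro nn_integral_FTC_Icc)
    fix a assume a: "a \<in> {0..v / \<alpha>}"
    show "((\<lambda>a. (v * a - \<alpha> * a\<^sup>2 / 2) / \<beta>) has_real_derivative (v - \<alpha> * a) / \<beta>) (at a)"
      using assms by (auto intro!: derivative_eq_intros)
    have "\<alpha> * a \<le> v" using a assms by (simp add: field_simps)
    then show "0 \<le> (v - \<alpha> * a) / \<beta>" using assms by simp
  qed (use assms in auto)
  also have "\<dots> = ennreal (v\<^sup>2 / (2 * \<alpha> * \<beta>))"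
    using assms by (intro arg_cong[where f=ennreal]) (simp add: field_simps power2_eq_square)
  finally show ?thesis .
qed

lemma gauss_abs_gt:
  assumes v: "0 < v" and c: "0 \<le> c"
  shows "emeasure (gauss v) {x. c < \<bar>x\<bar>} = ennreal (gtail v c)"
proof -
  interpret prob_space "gauss v" by (rule prob_space_gauss) fact
  have "emeasure (gauss v) {..<-c} = emeasure (distr (gauss v) borel uminus) {..<-c}"
    by (simp add: distr_gauss_uminus)
  also have "\<dots> = emeasure (gauss v) {c<..}"
    by (subst emeasure_distr) (auto intro!: arg_cong[where f="emeasure (gauss v)"])
  finally have *: "emeasure (gauss v) {..<-c} = emeasure (gauss v) {c<..}" .
  have "{x. c < \<bar>x\<bar>} = {c<..} \<union> {..<-c}" using c by auto
  then have "emeasure (gauss v) {x. c < \<bar>x\<bar>} = emeasure (gauss v) {c<..} + emeasure (gauss v) {..<-c}"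
    using c by (simp, subst plus_emeasure) auto
  then show ?thesis by (simp add: * ennreal_gtail[OF v] mult_2)
qed

text \<open>Layer cake in two variables: T^2 / (2 \<alpha> \<beta>) is the area of the triangle
  \<alpha> a + \<beta> b < T in the positive quadrant, and Fubini exchanges area and expectation. At
  x = 0 each tail in the reflection series depends on (a, b) through such a linear form.\<close>

lemma (in prob_space) nn_integral_square_layers:
  fixes T :: "'a \<Rightarrow> real" and \<alpha> \<beta> :: real
  assumes [measurable]: "T \<in> borel_measurable M" and T: "\<And>\<omega>. 0 \<le> T \<omega>" and \<alpha>: "0 < \<alpha>" "0 < \<beta>"
  shows "(\<integral>\<^sup>+\<omega>. ennreal ((T \<omega>)\<^sup>2 / (2 * \<alpha> * \<beta>)) \<partial>M) =
    (\<integral>\<^sup>+p. emeasure M {\<omega>\<in>space M. \<alpha> * fst p + \<beta> * snd p < T \<omega>} * indicator ({0<..} \<times> {0<..}) p \<partial>(lborel \<Otimes>\<^sub>M lborel))"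
proof -
  let ?L = "lborel \<Otimes>\<^sub>M lborel :: (real \<times> real) measure"
  interpret P: pair_sigma_finite M ?L by standard
  have "(\<integral>\<^sup>+\<omega>. ennreal ((T \<omega>)\<^sup>2 / (2 * \<alpha> * \<beta>)) \<partial>M)
     = (\<integral>\<^sup>+\<omega>. (\<integral>\<^sup>+p. indicator {\<omega>\<in>space M. \<alpha> * fst p + \<beta> * snd p < T \<omega>} \<omega> * indicator ({0<..} \<times> {0<..}) p \<partial>?L) \<partial>M)"
  proof (rule nn_integral_cong)
    fix \<omega> assume \<omega>: "\<omega> \<in> space M"
    have "ennreal ((T \<omega>)\<^sup>2 / (2 * \<alpha> * \<beta>)) = (\<integral>\<^sup>+p. indicator {(a, b). 0 < a \<and> 0 < b \<and> \<alpha> * a + \<beta> * b < T \<omega>} p \<partial>?L)"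
    proof -
      have "{(a, b). 0 < a \<and> 0 < b \<and> \<alpha> * a + \<beta> * b < T \<omega>} = {p\<in>space (borel \<Otimes>\<^sub>M borel). 0 < fst p \<and> 0 < snd p \<and> \<alpha> * fst p + \<beta> * snd p < T \<omega>}"
        by (auto simp: space_pair_measure)
      also have "\<dots> \<in> sets (borel \<Otimes>\<^sub>M borel)" by measurable
      finally have "{(a, b). 0 < a \<and> 0 < b \<and> \<alpha> * a + \<beta> * b < T \<omega>} \<in> sets ?L" by (simp cong: sets_pair_measure_cong)
      then show ?thesis using emeasure_triangle[OF \<alpha> T[of \<omega>]] by simp
    qed
    also have "\<dots> = (\<integral>\<^sup>+p. indicator {\<omega>\<in>space M. \<alpha> * fst p + \<beta> * snd p < T \<omega>} \<omega> * indicator ({0<..} \<times> {0<..}) p \<partial>?L)"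
      using \<omega> by (intro nn_integral_cong) (auto simp: indicator_def split: if_splits)
    finally show "ennreal ((T \<omega>)\<^sup>2 / (2 * \<alpha> * \<beta>)) = \<dots>" .
  qed
  also have "\<dots> = (\<integral>\<^sup>+p. (\<integral>\<^sup>+\<omega>. indicator {\<omega>\<in>space M. \<alpha> * fst p + \<beta> * snd p < T \<omega>} \<omega> * indicator ({0<..} \<times> {0<..}) p \<partial>M) \<partial>?L)"
    by (rule P.Fubini'[symmetric]) measurable
  also have "\<dots> = (\<integral>\<^sup>+p. emeasure M {\<omega>\<in>space M. \<alpha> * fst p + \<beta> * snd p < T \<omega>} * indicator ({0<..} \<times> {0<..}) p \<partial>?L)"
    by (intro nn_integral_cong) (simp add: nn_integral_multc)
  finally show ?thesis .
qed

text \<open>Layers of |X| for a standard normal X, whose tail is \<open>gtail 1\<close> and whose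
  second moment is 1.\<close>

lemma nn_integral_gtail_quadrant:
  assumes "0 < \<alpha>" "0 < \<beta>"
  shows "(\<integral>\<^sup>+p. ennreal (gtail 1 (\<alpha> * fst p + \<beta> * snd p)) * indicator ({0<..} \<times> {0<..}) p \<partial>(lborel \<Otimes>\<^sub>M lborel)) = ennreal (1 / (2 * \<alpha> * \<beta>))"
proof -
  interpret G: prob_space "gauss 1" by (rule prob_space_gauss) simp
  have "(\<integral>\<^sup>+p. ennreal (gtail 1 (\<alpha> * fst p + \<beta> * snd p)) * indicator ({0<..} \<times> {0<..}) p \<partial>(lborel \<Otimes>\<^sub>M lborel))
     = (\<integral>\<^sup>+x. ennreal (\<bar>x\<bar>\<^sup>2 / (2 * \<alpha> * \<beta>)) \<partial>gauss 1)"
    using assms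
    by (subst G.nn_integral_square_layers) (auto intro!: nn_integral_cong simp: gauss_abs_gt indicator_def)
  also have "\<dots> = ennreal (1 / (2 * \<alpha> * \<beta>))"
    using has_bochner_integral_divide_zero[OF gauss_moment(1)[of 1], of "2 * \<alpha> * \<beta>"] assms
    by (subst nn_integral_eq_integral) (auto simp: has_bochner_integral_iff)
  finally show ?thesis .
qed

text \<open>The summand is the integral over a, b > 0 of the reflection term
  \<open>alt_term 1 a b 0 k\<close>: its two tails contribute 1 / (2 k (k - 1)) each.\<close>

definition feller :: "nat \<Rightarrow> real" where
  "feller m = altsum (\<lambda>k. 1 / (real k * (real k - 1))) m"

lemma feller_tendsto: "feller \<longlonglongrightarrow> 2 * ln 2 - 1"
proof -
  define s where "s = (\<lambda>n. \<Sum>k<n. (-1) ^ k / real (Suc k))"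
  \<comment> \<open>By 1 / (k (k - 1)) = 1 / (k - 1) - 1 / k the sum splits into two alternating
    harmonic sums. One lacks its first term, which gives the -1; the other is one term shorter,
    which gives the last fraction.\<close>
  have f: "feller m = 2 * s (2 * m + 2) - 1 + 1 / real (2 * m + 2)" for m
  proof (induction m)
    case 0
    show ?case by (simp add: feller_def s_def numeral_2_eq_2)
  next
    case (Suc m)
    have "s (2 * Suc m + 2) = s (2 * m + 2) + 1 / (2 * real m + 3) - 1 / (2 * real m + 4)"
      by (simp add: s_def numeral_eq_Suc algebra_simps power_add)
    moreover have "feller (Suc m) = feller m - 1 / ((2 * real m + 3) * (2 * real m + 2)) + 1 / ((2 * real m + 4) * (2 * real m + 3))"
      by (simp add: feller_def algebra_simps)
    moreover have "1 / ((2 * real m + 3) * (2 * real m + 2)) = 1 / (2 * real m + 2) - 1 / (2 * real m + 3)"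
      "1 / ((2 * real m + 4) * (2 * real m + 3)) = 1 / (2 * real m + 3) - 1 / (2 * real m + 4)"
      by (simp_all add: divide_simps add_nonneg_eq_0_iff)
    ultimately show ?case using Suc by (simp add: add_ac)
  qed
  have "s \<longlonglongrightarrow> ln 2" using alternating_harmonic_series_sums by (simp add: sums_def s_def)
  then have "(\<lambda>m. s (2 * m + 2)) \<longlonglongrightarrow> ln 2"
    using LIMSEQ_subseq_LIMSEQ[of s _ "\<lambda>m. 2 * m + 2"] by (simp add: o_def strict_mono_def)
  moreover have "(\<lambda>m. 1 / real (2 * m + 2)) \<longlonglongrightarrow> 0"
    using LIMSEQ_subseq_LIMSEQ[OF lim_1_over_n, of "\<lambda>m. 2 * m + 2"] by (simp add: o_def strict_mono_def)
  ultimately have "(\<lambda>m. 2 * s (2 * m + 2) - 1 + 1 / real (2 * m + 2)) \<longlonglongrightarrow> 2 * ln 2 - 1 + 0"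
    by (intro tendsto_intros)
  then show ?thesis unfolding f[abs_def, symmetric] by simp
qed

text \<open>The series has terms of both signs, so it is integrated term by term in the Bochner
  sense; only the nonnegative total \<open>hit_bound\<close> is moved back to the nonnegative
  integral.\<close>

lemma feller_nonneg: "0 \<le> feller m"
  and nn_integral_hit_bound: "(\<integral>\<^sup>+p. ennreal (hit_bound 1 (fst p) (snd p) m 0) * indicator ({0<..} \<times> {0<..}) p \<partial>(lborel \<Otimes>\<^sub>M lborel)) = ennreal (feller m)"
proof -
  let ?L = "lborel \<Otimes>\<^sub>M lborel :: (real \<times> real) measure"
  let ?Q = "{0<..} \<times> {0<..} :: (real \<times> real) set"
  note [measurable] = borel_measurable_gtail[of 1, simplified]
  have g: "has_bochner_integral ?L (\<lambda>p. indicator ?Q p * gtail 1 (\<alpha> * fst p + \<beta> * snd p)) (1 / (2 * \<alpha> * \<beta>))"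
    if "0 < \<alpha>" "0 < \<beta>" for \<alpha> \<beta> :: real
  proof (rule has_bochner_integral_nn_integral)
    show "(\<integral>\<^sup>+p. ennreal (indicator ?Q p * gtail 1 (\<alpha> * fst p + \<beta> * snd p)) \<partial>?L) = ennreal (1 / (2 * \<alpha> * \<beta>))"
      unfolding nn_integral_gtail_quadrant[OF that, symmetric]
      by (intro nn_integral_cong) (auto simp: indicator_def)
  qed (use that in \<open>auto simp: gtail_nonneg\<close>)
  have t: "has_bochner_integral ?L (\<lambda>p. indicator ?Q p * alt_term 1 (fst p) (snd p) 0 k) (1 / (real k * (real k - 1)))"
    if "2 \<le> k" for k
  proof -
    have "1 / (2 * real k * (real k - 1)) + 1 / (2 * (real k - 1) * real k) = 1 / (real k * (real k - 1))"
      using that by (simp add: divide_simps)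
    then show ?thesis
      using has_bochner_integral_add[OF g[of "real k" "real k - 1"] g[of "real k - 1" "real k"]] that
      by (simp add: alt_term_def distrib_left)
  qed
  have i: "indicator ?Q p * altsum (alt_term 1 (fst p) (snd p) 0) m = altsum (\<lambda>k. indicator ?Q p * alt_term 1 (fst p) (snd p) 0 k) m" for p
    by (induction m) (auto simp: algebra_simps)
  have "has_bochner_integral ?L (\<lambda>p. indicator ?Q p * hit_bound 1 (fst p) (snd p) m 0) (feller m)"
    unfolding hit_bound_def feller_def i by (intro has_bochner_integral_altsum t)
  moreover from this have "feller m = (\<integral>p. indicator ?Q p * hit_bound 1 (fst p) (snd p) m 0 \<partial>?L)"
    by (simp add: has_bochner_integral_iff)
  then show "0 \<le> feller m"
    by (auto simp: indicator_def intro!: Bochner_Integration.integral_nonneg hit_bound_nonneg)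
  moreover have "0 \<le> indicator ?Q p * hit_bound 1 (fst p) (snd p) m 0" for p
    by (auto simp: indicator_def intro!: hit_bound_nonneg)
  ultimately have "(\<integral>\<^sup>+p. ennreal (indicator ?Q p * hit_bound 1 (fst p) (snd p) m 0) \<partial>?L) = ennreal (feller m)"
    by (subst nn_integral_eq_integral) (auto simp: has_bochner_integral_iff)
  moreover have "(\<integral>\<^sup>+p. ennreal (indicator ?Q p * hit_bound 1 (fst p) (snd p) m 0) \<partial>?L) = (\<integral>\<^sup>+p. ennreal (hit_bound 1 (fst p) (snd p) m 0) * indicator ?Q p \<partial>?L)"
    by (intro nn_integral_cong) (auto simp: indicator_def)
  ultimately show "(\<integral>\<^sup>+p. ennreal (hit_bound 1 (fst p) (snd p) m 0) * indicator ?Q p \<partial>?L) = ennreal (feller m)"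
    by simp
qed

context prob_space
begin

text \<open>Layer cake with rectangles: the product is the area of the points (a, b) with 0 < a < S
  and 0 < b < J, so its expectation is the integral of the joint tail.\<close>

lemma nn_integral_prod_layers:
  fixes S J :: "'a \<Rightarrow> real"
  assumes [measurable]: "S \<in> borel_measurable M" "J \<in> borel_measurable M"
    and nn: "\<And>\<omega>. 0 \<le> S \<omega>" "\<And>\<omega>. 0 \<le> J \<omega>"
  shows "(\<integral>\<^sup>+\<omega>. ennreal (S \<omega> * J \<omega>) \<partial>M) =
    (\<integral>\<^sup>+p. emeasure M {\<omega>\<in>space M. fst p < S \<omega> \<and> snd p < J \<omega>} * indicator ({0<..} \<times> {0<..}) p \<partial>(lborel \<Otimes>\<^sub>M lborel))"
proof -
  let ?L = "lborel \<Otimes>\<^sub>M lborel :: (real \<times> real) measure"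
  interpret P: pair_sigma_finite M ?L by standard
  have "(\<integral>\<^sup>+\<omega>. ennreal (S \<omega> * J \<omega>) \<partial>M)
     = (\<integral>\<^sup>+\<omega>. (\<integral>\<^sup>+p. indicator {\<omega>\<in>space M. fst p < S \<omega> \<and> snd p < J \<omega>} \<omega> * indicator ({0<..} \<times> {0<..}) p \<partial>?L) \<partial>M)"
  proof (rule nn_integral_cong)
    fix \<omega> assume \<omega>: "\<omega> \<in> space M"
    have "ennreal (S \<omega> * J \<omega>) = emeasure ?L ({0<..<S \<omega>} \<times> {0<..<J \<omega>})"
      using nn[of \<omega>] by (subst lborel.emeasure_pair_measure_Times) (auto simp: ennreal_mult)
    also have "\<dots> = (\<integral>\<^sup>+p. indicator ({0<..<S \<omega>} \<times> {0<..<J \<omega>}) p \<partial>?L)" by simp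
    also have "\<dots> = (\<integral>\<^sup>+p. indicator {\<omega>\<in>space M. fst p < S \<omega> \<and> snd p < J \<omega>} \<omega> * indicator ({0<..} \<times> {0<..}) p \<partial>?L)"
      using \<omega> by (intro nn_integral_cong) (auto simp: indicator_def split: if_splits)
    finally show "ennreal (S \<omega> * J \<omega>) = \<dots>" .
  qed
  also have "\<dots> = (\<integral>\<^sup>+p. (\<integral>\<^sup>+\<omega>. indicator {\<omega>\<in>space M. fst p < S \<omega> \<and> snd p < J \<omega>} \<omega> * indicator ({0<..} \<times> {0<..}) p \<partial>M) \<partial>?L)"
    by (rule P.Fubini'[symmetric]) measurable
  also have "\<dots> = (\<integral>\<^sup>+p. emeasure M {\<omega>\<in>space M. fst p < S \<omega> \<and> snd p < J \<omega>} * indicator ({0<..} \<times> {0<..}) p \<partial>?L)"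
    by (intro nn_integral_cong) (simp add: nn_integral_multc)
  finally show ?thesis .
qed

text \<open>\<open>S\<close> has a lighter tail than |X| for a standard normal X. Triangles with
  \<alpha> = \<beta> = 1 measure half the square, hence the factor 2.\<close>

lemma second_moment_le_1:
  fixes S :: "'a \<Rightarrow> real"
  assumes [measurable]: "S \<in> borel_measurable M" and nn: "\<And>\<omega>. 0 \<le> S \<omega>"
    and S: "\<And>a. 0 \<le> a \<Longrightarrow> prob {\<omega>\<in>space M. a < S \<omega>} \<le> gtail 1 a"
  shows "(\<integral>\<^sup>+\<omega>. ennreal ((S \<omega>)\<^sup>2) \<partial>M) \<le> 1"
proof -
  have "(\<integral>\<^sup>+\<omega>. ennreal ((S \<omega>)\<^sup>2) \<partial>M) = (\<integral>\<^sup>+\<omega>. 2 * ennreal ((S \<omega>)\<^sup>2 / (2 * 1 * 1)) \<partial>M)"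
    by (intro nn_integral_cong) (simp add: ennreal_mult'[symmetric] flip: ennreal_numeral)
  also have "\<dots> = 2 * (\<integral>\<^sup>+\<omega>. ennreal ((S \<omega>)\<^sup>2 / (2 * 1 * 1)) \<partial>M)"
    by (rule nn_integral_cmult) measurable
  also have "\<dots> \<le> 2 * (\<integral>\<^sup>+p. ennreal (gtail 1 (1 * fst p + 1 * snd p)) * indicator ({0<..} \<times> {0<..}) p \<partial>(lborel \<Otimes>\<^sub>M lborel))"
    using nn_integral_square_layers[of S 1 1] nn S
    by (auto simp: emeasure_eq_measure indicator_def intro!: mult_left_mono nn_integral_mono ennreal_leI)
  also have "\<dots> = 2 * ennreal (1 / 2)" by (subst nn_integral_gtail_quadrant) auto
  also have "\<dots> = ennreal (2 * (1 / 2))" by (subst ennreal_mult) auto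
  finally show ?thesis by simp
qed

text \<open>Expanding the square gives the bound 1 + 1 + 2 \<open>feller m\<close> for every
  \<open>m\<close>. The limit in \<open>m\<close> is taken among these numerical bounds, so integral
  and limit are never exchanged.\<close>

theorem range_second_moment:
  fixes S J :: "'a \<Rightarrow> real"
  assumes [measurable]: "S \<in> borel_measurable M" "J \<in> borel_measurable M"
    and nn: "\<And>\<omega>. 0 \<le> S \<omega>" "\<And>\<omega>. 0 \<le> J \<omega>"
    and S: "\<And>a. 0 \<le> a \<Longrightarrow> prob {\<omega>\<in>space M. a < S \<omega>} \<le> gtail 1 a"
    and J: "\<And>a. 0 \<le> a \<Longrightarrow> prob {\<omega>\<in>space M. a < J \<omega>} \<le> gtail 1 a"
    and SJ: "\<And>a b m. 0 \<le> a \<Longrightarrow> 0 \<le> b \<Longrightarrow> prob {\<omega>\<in>space M. a < S \<omega> \<and> b < J \<omega>} \<le> hit_bound 1 a b m 0"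
  shows "(\<integral>\<^sup>+\<omega>. ennreal ((S \<omega> + J \<omega>)\<^sup>2) \<partial>M) \<le> ennreal (4 * ln 2)"
proof -
  have b: "(\<integral>\<^sup>+\<omega>. ennreal ((S \<omega> + J \<omega>)\<^sup>2) \<partial>M) \<le> ennreal (2 + 2 * feller m)" for m
  proof -
    have "(\<integral>\<^sup>+\<omega>. ennreal (S \<omega> * J \<omega>) \<partial>M) \<le> (\<integral>\<^sup>+p. ennreal (hit_bound 1 (fst p) (snd p) m 0) * indicator ({0<..} \<times> {0<..}) p \<partial>(lborel \<Otimes>\<^sub>M lborel))"
      unfolding nn_integral_prod_layers[OF assms(1,2) nn] using SJ
      by (auto simp: emeasure_eq_measure indicator_def intro!: nn_integral_mono ennreal_leI)
    then have "(\<integral>\<^sup>+\<omega>. ennreal (S \<omega> * J \<omega>) \<partial>M) \<le> ennreal (feller m)"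
      by (simp add: nn_integral_hit_bound)
    moreover have "(\<integral>\<^sup>+\<omega>. ennreal ((S \<omega> + J \<omega>)\<^sup>2) \<partial>M) = (\<integral>\<^sup>+\<omega>. ennreal ((S \<omega>)\<^sup>2) + ennreal ((J \<omega>)\<^sup>2) + 2 * ennreal (S \<omega> * J \<omega>) \<partial>M)"
      using nn by (intro nn_integral_cong)
        (simp add: power2_sum ennreal_plus[symmetric] ennreal_mult'[symmetric] mult.assoc del: ennreal_plus flip: ennreal_numeral)
    moreover have "\<dots> = (\<integral>\<^sup>+\<omega>. ennreal ((S \<omega>)\<^sup>2) \<partial>M) + (\<integral>\<^sup>+\<omega>. ennreal ((J \<omega>)\<^sup>2) \<partial>M) + 2 * (\<integral>\<^sup>+\<omega>. ennreal (S \<omega> * J \<omega>) \<partial>M)"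
      by (simp add: nn_integral_add nn_integral_cmult)
    ultimately have "(\<integral>\<^sup>+\<omega>. ennreal ((S \<omega> + J \<omega>)\<^sup>2) \<partial>M) \<le> 1 + 1 + 2 * ennreal (feller m)"
      using second_moment_le_1[OF assms(1) nn(1) S] second_moment_le_1[OF assms(2) nn(2) J]
      by (simp only:) (intro add_mono mult_left_mono; simp)
    moreover have "0 \<le> feller m"
      by (rule feller_nonneg)
    ultimately show ?thesis
      by (simp add: ennreal_plus ennreal_mult' flip: ennreal_numeral)
  qed
  have "(\<lambda>m. ennreal (2 + 2 * feller m)) \<longlonglongrightarrow> ennreal (2 + 2 * (2 * ln 2 - 1))"
    by (intro tendsto_intros feller_tendsto tendsto_ennrealI)
  then have "(\<integral>\<^sup>+\<omega>. ennreal ((S \<omega> + J \<omega>)\<^sup>2) \<partial>M) \<le> ennreal (2 + 2 * (2 * ln 2 - 1))"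
    by (rule LIMSEQ_le_const) (use b in auto)
  then show ?thesis by simp
qed

end

section \<open>Dyadic approximation of Brownian paths\<close>

text \<open>Dyadic grids are nested, so the maxima increase with \<open>n\<close>; the minimum
  enters \<open>grid_range\<close> as the maximum of the negated path.\<close>

definition grid_max :: "nat \<Rightarrow> real \<Rightarrow> (real \<Rightarrow> real) \<Rightarrow> real" where
  "grid_max n t w = Max ((\<lambda>j. w (t * real j / 2 ^ n)) ` {..2 ^ n})"

definition grid_range :: "nat \<Rightarrow> real \<Rightarrow> (real \<Rightarrow> real) \<Rightarrow> real" where
  "grid_range n t w = grid_max n t w + grid_max n t (\<lambda>s. - w s)"

lemma grid_max_ge: "j \<le> 2 ^ n \<Longrightarrow> w (t * real j / 2 ^ n) \<le> grid_max n t w"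
  unfolding grid_max_def by (intro Max_ge) auto

lemma grid_max_le: "(\<And>j. j \<le> 2 ^ n \<Longrightarrow> w (t * real j / 2 ^ n) \<le> c) \<Longrightarrow> grid_max n t w \<le> c"
  unfolding grid_max_def by (subst Max_le_iff) auto

lemma grid_max_Suc: "grid_max n t w \<le> grid_max (Suc n) t w"
proof (rule grid_max_le)
  fix j :: nat assume "j \<le> 2 ^ n"
  then show "w (t * real j / 2 ^ n) \<le> grid_max (Suc n) t w"
    using grid_max_ge[of "2 * j" "Suc n" w t] by (simp add: mult.left_commute)
qed

lemma grid_max_mono: "m \<le> n \<Longrightarrow> grid_max m t w \<le> grid_max n t w"
  by (rule lift_Suc_mono_le[of "\<lambda>n. grid_max n t w", OF grid_max_Suc])

lemma grid_range_mono: "m \<le> n \<Longrightarrow> grid_range m t w \<le> grid_range n t w"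
  unfolding grid_range_def by (intro add_mono grid_max_mono)

lemma grid_range_nonneg: "0 \<le> grid_range n t w"
  using grid_max_ge[of 0 n w t] grid_max_ge[of 0 n "\<lambda>s. - w s" t] by (simp add: grid_range_def)

lemma abs_diff_le_grid_range:
  "i \<le> 2 ^ n \<Longrightarrow> j \<le> 2 ^ n \<Longrightarrow> \<bar>w (t * real i / 2 ^ n) - w (t * real j / 2 ^ n)\<bar> \<le> grid_range n t w"
  using grid_max_ge[of i n w t] grid_max_ge[of i n "\<lambda>s. - w s" t]
    grid_max_ge[of j n w t] grid_max_ge[of j n "\<lambda>s. - w s" t]
  by (simp add: grid_range_def abs_le_iff)

lemma measurable_grid_max [measurable (raw)]:
  assumes "\<And>s. 0 \<le> s \<Longrightarrow> (\<lambda>x. f x s) \<in> borel_measurable M" "0 \<le> t"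
  shows "(\<lambda>x. grid_max n t (f x)) \<in> borel_measurable M"
  unfolding grid_max_def using assms by (intro borel_measurable_Max) auto

lemma measurable_grid_range [measurable (raw)]:
  assumes "\<And>s. 0 \<le> s \<Longrightarrow> (\<lambda>x. f x s) \<in> borel_measurable M" "0 \<le> t"
  shows "(\<lambda>x. grid_range n t (f x)) \<in> borel_measurable M"
  unfolding grid_range_def using assms
  by (intro borel_measurable_add measurable_grid_max borel_measurable_uminus) auto

lemma grid_max_tendsto:
  assumes c: "continuous_on {0..t} w" and t: "0 \<le> t"
  shows "(\<lambda>n. grid_max n t w) \<longlonglongrightarrow> (SUP s\<in>{0..t}. w s)"
proof -
  obtain s where s: "s \<in> {0..t}" and max: "\<And>r. r \<in> {0..t} \<Longrightarrow> w r \<le> w s"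
    using continuous_attains_sup[of "{0..t}" w] c t by auto
  then have sup: "(SUP s\<in>{0..t}. w s) = w s"
    by (intro cSup_eq_maximum) auto
  show ?thesis
  proof (cases "t = 0")
    case True
    then show ?thesis by (simp add: grid_max_def image_constant_conv)
  next
    case False
    then have t: "0 < t" using t by simp
    \<comment> \<open>Rounding a maximiser \<open>s\<close> down to the grid gives points within t /
      2^n of it; continuity squeezes the grid maximum between \<open>w (r n)\<close> and
      \<open>w s\<close>.\<close>
    define r where "r = (\<lambda>n. t * real (nat \<lfloor>s / t * 2 ^ n\<rfloor>) / 2 ^ n)"
    have q: "0 \<le> s / t" "s / t \<le> 1" using s t by auto
    have fl: "real (nat \<lfloor>s / t * 2 ^ n\<rfloor>) = of_int \<lfloor>s / t * 2 ^ n\<rfloor>" for n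
    proof -
      have "0 \<le> s / t * 2 ^ n" using q(1) by (rule mult_nonneg_nonneg) simp
      then show ?thesis by (intro of_nat_nat) (simp only: zero_le_floor)
    qed
    have r1: "r n \<le> s" for n
    proof -
      have "r n \<le> t * (s / t * 2 ^ n) / 2 ^ n"
        unfolding r_def fl using t by (intro divide_right_mono mult_left_mono) auto
      then show ?thesis using t by simp
    qed
    have r2: "s - t / 2 ^ n \<le> r n" for n
    proof -
      have "t * (s / t * 2 ^ n - 1) / 2 ^ n \<le> r n"
        unfolding r_def fl using t
        by (intro divide_right_mono mult_left_mono real_of_int_floor_ge_diff_one) auto
      moreover have "t * (s / t * 2 ^ n - 1) / 2 ^ n = s - t / 2 ^ n" using t by (simp add: field_simps)
      ultimately show ?thesis by simp
    qed
    have j: "nat \<lfloor>s / t * 2 ^ n\<rfloor> \<le> 2 ^ n" for n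
    proof -
      have "s / t * 2 ^ n \<le> 1 * 2 ^ n" using q by (intro mult_right_mono) auto
      then have "\<lfloor>s / t * 2 ^ n\<rfloor> \<le> 2 ^ n"
        by (metis floor_mono floor_of_int mult_1 of_int_numeral of_int_power)
      then show ?thesis by (simp add: nat_le_iff)
    qed
    have r0: "0 \<le> r n" for n using t by (simp add: r_def)
    have "r \<longlonglongrightarrow> s"
    proof (rule tendsto_sandwich)
      show "(\<lambda>n. s - t / 2 ^ n) \<longlonglongrightarrow> s"
        using tendsto_diff[OF tendsto_const[of s] tendsto_mult[OF tendsto_const[of t] LIMSEQ_inverse_realpow_zero[of 2]]]
        by (simp add: divide_inverse)
    qed (use r1 r2 in auto)
    then have "(\<lambda>n. w (r n)) \<longlonglongrightarrow> w s"
      using c s r0 r1 by (intro continuous_on_tendsto_compose[OF c]) (auto intro!: eventuallyI intro: order_trans[OF r1])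
    then show ?thesis unfolding sup
    proof (rule tendsto_sandwich[rotated 2])
      show "\<forall>\<^sub>F n in sequentially. w (r n) \<le> grid_max n t w"
        using grid_max_ge[OF j, of w t] by (simp add: r_def)
      show "\<forall>\<^sub>F n in sequentially. grid_max n t w \<le> w s"
      proof (intro always_eventually allI grid_max_le max)
        fix n j :: nat assume "j \<le> 2 ^ n"
        then have "real j \<le> 2 ^ n" by (metis of_nat_le_iff of_nat_numeral of_nat_power)
        then have "t * real j \<le> t * 2 ^ n" using t by simp
        then show "t * real j / 2 ^ n \<in> {0..t}" using t by (simp add: field_simps)
      qed
    qed simp
  qed
qed

lemma grid_range_tendsto:
  assumes c: "continuous_on {0..t} w" and t: "0 \<le> t"
  shows "(\<lambda>n. grid_range n t w) \<longlonglongrightarrow> (SUP s\<in>{0..t}. w s) - (INF s\<in>{0..t}. w s)"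
proof -
  have "(SUP s\<in>{0..t}. - w s) = - (INF s\<in>{0..t}. w s)"
    by (simp add: Inf_real_def image_image)
  then show ?thesis
    unfolding grid_range_def
    using tendsto_add[OF grid_max_tendsto[OF assms] grid_max_tendsto[OF continuous_on_minus[OF c] t]] by simp
qed

section \<open>Grid increments as Gaussian walks, and the scaling of their range\<close>

definition grid_inc :: "nat \<Rightarrow> real \<Rightarrow> (real \<Rightarrow> real) \<Rightarrow> nat \<Rightarrow> real" where
  "grid_inc n t w j = w (t * real (Suc j) / 2 ^ n) - w (t * real j / 2 ^ n)"

lemma walk_grid_inc: "walk (grid_inc n t w) j = w (t * real j / 2 ^ n) - w 0"
  by (induction j) (auto simp: grid_inc_def)

lemma wmax_eq_Max: "wmax z n = Max (walk z ` {..n})"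
proof (induction n)
  case (Suc n)
  then show ?case by (simp add: atMost_Suc max.commute del: walk.simps)
qed simp

text \<open>The starting value is carried along because paths start at 0 only almost surely; it
  cancels in \<open>grid_range_eq_walk\<close>.\<close>

lemma wmax_grid_inc: "wmax (grid_inc n t w) (2 ^ n) = grid_max n t w - w 0"
proof -
  have "wmax (grid_inc n t w) (2 ^ n) = Max ((\<lambda>j. w (t * real j / 2 ^ n) + (- w 0)) ` {..2 ^ n})"
    by (simp add: wmax_eq_Max walk_grid_inc)
  also have "\<dots> = grid_max n t w + (- w 0)"
    unfolding grid_max_def by (rule Max_add_commute) auto
  finally show ?thesis by simp
qed

lemma wmin_grid_inc: "wmin (grid_inc n t w) (2 ^ n) = - grid_max n t (\<lambda>s. - w s) - w 0"
proof -
  have "grid_inc n t w = (\<lambda>i. - grid_inc n t (\<lambda>s. - w s) i)" by (auto simp: grid_inc_def)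
  then have "wmin (grid_inc n t w) (2 ^ n) = - wmax (grid_inc n t (\<lambda>s. - w s)) (2 ^ n)"
    by (metis wmin_uminus)
  then show ?thesis by (simp add: wmax_grid_inc)
qed

lemma grid_range_eq_walk:
  "grid_range n t w = wmax (grid_inc n t w) (2 ^ n) - wmin (grid_inc n t w) (2 ^ n)"
  by (simp add: grid_range_def wmax_grid_inc wmin_grid_inc)

text \<open>A reference law that mentions neither process nor time; the normalised grid ranges at
  all times are identified with it.\<close>

definition walk_range_law :: "real \<Rightarrow> nat \<Rightarrow> real measure" where
  "walk_range_law h N = distr (PiM {..<N} (\<lambda>_. gauss h)) borel (\<lambda>z. wmax z N - wmin z N)"

lemma (in prob_space) distr_walk_range:
  assumes ind: "indep_vars (\<lambda>_. borel) \<xi> {..<N}"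
    and law: "\<And>j. j < N \<Longrightarrow> distr M borel (\<xi> j) = gauss h" and N: "0 < N"
  shows "distr M borel (\<lambda>\<omega>. wmax (\<lambda>k. \<xi> k \<omega>) N - wmin (\<lambda>k. \<xi> k \<omega>) N) = walk_range_law h N"
proof -
  have rv[measurable]: "\<xi> j \<in> borel_measurable M" if "j < N" for j
    using ind that by (auto simp: indep_vars_def)
  have "distr M (PiM {..<N} (\<lambda>_. borel)) (\<lambda>\<omega>. \<lambda>i\<in>{..<N}. \<xi> i \<omega>) = PiM {..<N} (\<lambda>i. distr M borel (\<xi> i))"
    using ind N rv by (subst (asm) indep_vars_iff_distr_eq_PiM') auto
  also have "\<dots> = PiM {..<N} (\<lambda>_. gauss h)" by (intro PiM_cong) (auto simp: law)
  finally have J: "PiM {..<N} (\<lambda>_. gauss h) = distr M (PiM {..<N} (\<lambda>_. borel)) (\<lambda>\<omega>. \<lambda>i\<in>{..<N}. \<xi> i \<omega>)" ..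
  have f: "(\<lambda>z. wmax z N - wmin z N) \<in> borel_measurable (PiM {..<N} (\<lambda>_. borel))"
    by (intro borel_measurable_diff measurable_wmax measurable_wmin measurable_component_singleton) auto
  have m: "(\<lambda>\<omega>. \<lambda>i\<in>{..<N}. \<xi> i \<omega>) \<in> M \<rightarrow>\<^sub>M PiM {..<N} (\<lambda>_. borel)"
    by (intro measurable_restrict) auto
  have "wmax (\<lambda>i\<in>{..<N}. \<xi> i \<omega>) N = wmax (\<lambda>k. \<xi> k \<omega>) N" "wmin (\<lambda>i\<in>{..<N}. \<xi> i \<omega>) N = wmin (\<lambda>k. \<xi> k \<omega>) N" for \<omega>
    by (auto intro!: wmax_cong wmin_cong)
  then show ?thesis
    unfolding walk_range_law_def J by (subst distr_distr[OF f m]) (simp add: o_def)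
qed

lemma (in prob_space) distr_eq_gauss:
  "distributed M lborel X (normal_density 0 (sqrt v)) \<Longrightarrow> distr M borel X = gauss v"
  unfolding gauss_def by (subst distributed_distr_eq_density[symmetric]) (auto intro!: distr_cong)

context standard_brownian_motion
begin

lemma indep_grid_inc:
  assumes "0 < t"
  shows "indep_vars (\<lambda>_. borel) (\<lambda>j \<omega>. grid_inc n t (\<lambda>s. B s \<omega>) j) {..<2 ^ n}"
  unfolding grid_inc_def using assms
  by (intro indep_increments[of "\<lambda>j. t * real j / 2 ^ n" "2 ^ n"]) (auto simp: divide_strict_right_mono)

lemma distributed_grid_inc:
  assumes "0 < t"
  shows "distributed M lborel (\<lambda>\<omega>. grid_inc n t (\<lambda>s. B s \<omega>) j) (normal_density 0 (sqrt (t / 2 ^ n)))"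
proof -
  have "t * real (Suc j) / 2 ^ n - t * real j / 2 ^ n = t / 2 ^ n"
    by (simp add: field_simps)
  then show ?thesis
    unfolding grid_inc_def using normal_increments[of "t * real j / 2 ^ n" "t * real (Suc j) / 2 ^ n"] assms
    by (simp add: divide_strict_right_mono)
qed

lemma distr_grid_inc:
  assumes "0 < t"
  shows "distr M borel (\<lambda>\<omega>. grid_inc n t (\<lambda>s. B s \<omega>) j) = gauss (t / 2 ^ n)"
  by (intro distr_eq_gauss distributed_grid_inc assms)

lemma measurable_grid_inc [measurable]:
  "0 < t \<Longrightarrow> (\<lambda>\<omega>. grid_inc n t (\<lambda>s. B s \<omega>) j) \<in> borel_measurable M"
  unfolding grid_inc_def by (intro borel_measurable_diff measurable) auto

text \<open>Increments over t / 2^n divided by sqrt t have variance 1 / 2^n, whatever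
  \<open>t\<close> is: Brownian scaling at grid level.\<close>

lemma distr_grid_range:
  assumes t: "0 < t"
  shows "distr M borel (\<lambda>\<omega>. grid_range n t (\<lambda>s. B s \<omega>) / sqrt t) = walk_range_law (1 / 2 ^ n) (2 ^ n)"
proof -
  let ?\<xi> = "\<lambda>j \<omega>. 1 / sqrt t * grid_inc n t (\<lambda>s. B s \<omega>) j"
  have "distr M borel (\<lambda>\<omega>. wmax (\<lambda>k. ?\<xi> k \<omega>) (2 ^ n) - wmin (\<lambda>k. ?\<xi> k \<omega>) (2 ^ n)) = walk_range_law (1 / 2 ^ n) (2 ^ n)"
  proof (rule distr_walk_range)
    show "indep_vars (\<lambda>_. borel) ?\<xi> {..<2 ^ n}"
      by (rule indep_vars_compose2[OF indep_grid_inc[OF t]]) auto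
    show "distr M borel (?\<xi> j) = gauss (1 / 2 ^ n)" for j
    proof (rule distr_eq_gauss)
      show "distributed M lborel (?\<xi> j) (normal_density 0 (sqrt (1 / 2 ^ n)))"
        using normal_density_affine[OF distributed_grid_inc[OF t, of n j], of "1 / sqrt t" 0] t
        by (simp add: real_sqrt_divide)
    qed
  qed simp
  moreover have "wmax (\<lambda>k. ?\<xi> k \<omega>) (2 ^ n) - wmin (\<lambda>k. ?\<xi> k \<omega>) (2 ^ n) = grid_range n t (\<lambda>s. B s \<omega>) / sqrt t" for \<omega>
    unfolding grid_range_eq_walk using t
    by (simp only: wmax_scale wmin_scale zero_le_divide_1_iff real_sqrt_ge_zero less_imp_le) (simp add: diff_divide_distrib)
  ultimately show ?thesis by simp
qed

text \<open>The event on grid \<open>n\<close> is contained in the one on any finer grid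
  \<open>k\<close>, so the walk bound applies with \<open>k\<close> arbitrary. First
  \<open>k\<close> grows with \<open>e\<close> fixed, which removes the long jumps; then
  \<open>e\<close> tends to 0, which removes the Lipschitz term. The order matters because the first
  error carries the factor 1 / e^4.\<close>

lemma prob_grid_max_both:
  assumes t: "0 < t" "t < 1" and ab: "0 \<le> a" "0 \<le> b"
  shows "prob {\<omega>\<in>space M. a < grid_max n t (\<lambda>s. B s \<omega>) - B 0 \<omega> \<and> b < grid_max n t (\<lambda>s. - B s \<omega>) + B 0 \<omega>}
    \<le> hit_bound 1 a b m 0"
proof -
  let ?A = "\<lambda>n. {\<omega>\<in>space M. a < grid_max n t (\<lambda>s. B s \<omega>) - B 0 \<omega> \<and> b < grid_max n t (\<lambda>s. - B s \<omega>) + B 0 \<omega>}"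
  have A[measurable]: "?A k \<in> sets M" for k
  proof -
    have [measurable]: "B 0 \<in> borel_measurable M" by (rule measurable) simp
    have [measurable]: "(\<lambda>\<omega>. grid_max k t (\<lambda>s. B s \<omega>)) \<in> borel_measurable M"
      "(\<lambda>\<omega>. grid_max k t (\<lambda>s. - B s \<omega>)) \<in> borel_measurable M"
      using t by (auto intro!: measurable_grid_max borel_measurable_uminus measurable)
    show ?thesis by measurable
  qed
  have fin: "prob (?A n) \<le> hit_bound 1 a b m 0 + real m * (2 * e / sqrt (1 - t)) + 6 * t\<^sup>2 / e ^ 4 * (1 / 2 ^ k)"
    if e: "0 < e" and k: "n \<le> k" for e k
  proof -
    have "prob (?A n) \<le> prob (?A k)"
      using grid_max_mono[OF k] by (intro finite_measure_mono A) (fastforce intro: less_le_trans)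
    also have "?A k = {\<omega>\<in>space M. a < wmax (\<lambda>j. grid_inc k t (\<lambda>s. B s \<omega>) j) (2 ^ k) \<and> wmin (\<lambda>j. grid_inc k t (\<lambda>s. B s \<omega>) j) (2 ^ k) < - b}"
      by (auto simp: wmax_grid_inc wmin_grid_inc)
    \<comment> \<open>The reserve \<open>1 - t\<close> and the variance \<open>t\<close> of the walk
      add up to 1 at every grid level.\<close>
    also have "prob \<dots> \<le> hit_bound ((1 - t) + real (2 ^ k) * (t / 2 ^ k)) a b m 0 + real m * (2 * e / sqrt (1 - t))
        + real (2 ^ k) * (6 * (t / 2 ^ k)\<^sup>2 / e ^ 4)"
      using t e ab by (intro prob_walk_hits_both indep_grid_inc distr_grid_inc) auto
    also have "\<dots> = hit_bound 1 a b m 0 + real m * (2 * e / sqrt (1 - t)) + 6 * t\<^sup>2 / e ^ 4 * (1 / 2 ^ k)"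
      by (simp add: power2_eq_square)
    finally show ?thesis .
  qed
  have "prob (?A n) \<le> hit_bound 1 a b m 0 + real m * (2 * e / sqrt (1 - t))" if e: "0 < e" for e
  proof (rule LIMSEQ_le_const)
    have "(\<lambda>k. 1 / 2 ^ k :: real) \<longlonglongrightarrow> 0"
      using LIMSEQ_inverse_realpow_zero[of 2] by (simp add: divide_inverse)
    then have "(\<lambda>k. hit_bound 1 a b m 0 + real m * (2 * e / sqrt (1 - t)) + 6 * t\<^sup>2 / e ^ 4 * (1 / 2 ^ k))
       \<longlonglongrightarrow> hit_bound 1 a b m 0 + real m * (2 * e / sqrt (1 - t)) + 6 * t\<^sup>2 / e ^ 4 * 0"
      by (intro tendsto_intros)
    then show "(\<lambda>k. hit_bound 1 a b m 0 + real m * (2 * e / sqrt (1 - t)) + 6 * t\<^sup>2 / e ^ 4 * (1 / 2 ^ k))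
       \<longlonglongrightarrow> hit_bound 1 a b m 0 + real m * (2 * e / sqrt (1 - t))" by simp
  qed (use fin[OF e] in blast)
  then have "\<forall>\<^sub>F e in at_right 0. prob (?A n) \<le> hit_bound 1 a b m 0 + real m * (2 * e / sqrt (1 - t))"
    by (auto simp: eventually_at_right_field intro!: exI[of _ 1])
  moreover have "((\<lambda>e. hit_bound 1 a b m 0 + real m * (2 * e / sqrt (1 - t))) \<longlongrightarrow> hit_bound 1 a b m 0 + real m * (2 * 0 / sqrt (1 - t))) (at_right 0)"
    using t by (intro tendsto_intros) auto
  ultimately have "prob (?A n) \<le> hit_bound 1 a b m 0 + real m * (2 * 0 / sqrt (1 - t))"
    by (intro tendsto_lowerbound[where F="at_right 0"]) auto
  then show ?thesis by simp
qed

lemma grid_range_second_moment: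
  assumes t: "0 < t" "t < 1"
  shows "(\<integral>\<^sup>+\<omega>. ennreal ((grid_range n t (\<lambda>s. B s \<omega>))\<^sup>2) \<partial>M) \<le> ennreal (4 * ln 2)"
proof -
  let ?S = "\<lambda>\<omega>. grid_max n t (\<lambda>s. B s \<omega>) - B 0 \<omega>"
  let ?J = "\<lambda>\<omega>. grid_max n t (\<lambda>s. - B s \<omega>) + B 0 \<omega>"
  have [measurable]: "B 0 \<in> borel_measurable M" by (rule measurable) simp
  have [measurable]: "(\<lambda>\<omega>. grid_max n t (\<lambda>s. B s \<omega>)) \<in> borel_measurable M"
    "(\<lambda>\<omega>. grid_max n t (\<lambda>s. - B s \<omega>)) \<in> borel_measurable M"
    using t by (auto intro!: measurable_grid_max borel_measurable_uminus measurable)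
  have v: "1 - t + real (2 ^ n) * (t / 2 ^ n) = 1" by simp
  have "(\<integral>\<^sup>+\<omega>. ennreal ((?S \<omega> + ?J \<omega>)\<^sup>2) \<partial>M) \<le> ennreal (4 * ln 2)"
  proof (rule range_second_moment)
    show "0 \<le> ?S \<omega>" "0 \<le> ?J \<omega>" for \<omega>
      using grid_max_ge[of 0 n "\<lambda>s. B s \<omega>" t] grid_max_ge[of 0 n "\<lambda>s. - B s \<omega>" t] by auto
    show "prob {\<omega>\<in>space M. a < ?S \<omega>} \<le> gtail 1 a" if "0 \<le> a" for a
      using prob_wmax_le[OF indep_grid_inc[OF t(1), of n] distr_grid_inc[OF t(1)] _ _ that, of "1 - t"] t v
      by (simp add: wmax_grid_inc)
    show "prob {\<omega>\<in>space M. a < ?J \<omega>} \<le> gtail 1 a" if "0 \<le> a" for a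
      using prob_wmin_le[OF indep_grid_inc[OF t(1), of n] distr_grid_inc[OF t(1)] _ _ that, of "1 - t"] t v
      by (simp add: wmin_grid_inc add.commute)
    show "prob {\<omega>\<in>space M. a < ?S \<omega> \<and> b < ?J \<omega>} \<le> hit_bound 1 a b m 0" if "0 \<le> a" "0 \<le> b" for a b m
      using prob_grid_max_both[OF t that] .
  qed measurable
  then show ?thesis by (simp add: grid_range_def)
qed

text \<open>The bound has to be integrable at infinity. Four independent increments of variance t /
  4 all lie in [-1, 1], each with probability at most 3 / sqrt t, which gives order t^-2; two
  increments would give only t^-1.\<close>

lemma prob_grid_range_small:
  assumes t: "0 < t"
  shows "prob {\<omega>\<in>space M. grid_range 2 t (\<lambda>s. B s \<omega>) \<le> 1} \<le> 81 / t\<^sup>2"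
proof -
  let ?\<xi> = "\<lambda>j \<omega>. grid_inc 2 t (\<lambda>s. B s \<omega>) j"
  interpret G: prob_space "gauss (t / 4)" using t by (intro prob_space_gauss) simp
  have one: "prob (?\<xi> j -` {-1..1} \<inter> space M) \<le> 3 / sqrt t" for j
  proof -
    have "prob (?\<xi> j -` {-1..1} \<inter> space M) = measure (gauss (t / 4)) {-1..1}"
      using distr_grid_inc[OF t, of 2 j, symmetric] t by (simp add: measure_distr)
    \<comment> \<open>Enlarging to (-2, 1] makes the interval a difference of open half-lines, to
      which the Lipschitz bound for \<open>gtail\<close> applies with length 3.\<close>
    also have "\<dots> \<le> measure (gauss (t / 4)) ({-2<..} - {1<..})"
      by (intro G.finite_measure_mono) auto
    also have "\<dots> = measure (gauss (t / 4)) {-2<..} - measure (gauss (t / 4)) {1<..}"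
      by (intro G.finite_measure_Diff) auto
    also have "\<dots> \<le> 3 / sqrt t"
      using gtail_lipschitz[of "t / 4" "t / 4" "-2" 1] t by (simp add: gtail_def real_sqrt_divide)
    finally show ?thesis .
  qed
  have "prob {\<omega>\<in>space M. grid_range 2 t (\<lambda>s. B s \<omega>) \<le> 1} \<le> prob (\<Inter>j\<in>{..<4}. ?\<xi> j -` {-1..1} \<inter> space M)"
  proof (intro finite_measure_mono subsetI INT_I)
    fix \<omega> j assume "\<omega> \<in> {\<omega>\<in>space M. grid_range 2 t (\<lambda>s. B s \<omega>) \<le> 1}" "j \<in> {..<4::nat}"
    then show "\<omega> \<in> ?\<xi> j -` {-1..1} \<inter> space M"
      using abs_diff_le_grid_range[of "Suc j" 2 j "\<lambda>s. B s \<omega>" t] by (auto simp: grid_inc_def abs_le_iff)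
  next
    show "(\<Inter>j\<in>{..<4}. ?\<xi> j -` {-1..1} \<inter> space M) \<in> sets M"
      using t by (intro sets.finite_INT) (auto simp: lessThan_empty_iff)
  qed
  also have "\<dots> = (\<Prod>j\<in>{..<4}. prob (?\<xi> j -` {-1..1} \<inter> space M))"
    using indep_grid_inc[OF t, of 2] by (intro indep_varsD_finite[of "\<lambda>_. borel"]) (auto simp: lessThan_empty_iff)
  also have "\<dots> \<le> (\<Prod>j\<in>{..<4::nat}. 3 / sqrt t)"
    using one by (intro prod_mono) auto
  also have "\<dots> = 81 / t\<^sup>2"
    using t by (simp add: power_divide power4_eq_xxxx power2_eq_square)
  finally show ?thesis .
qed

end

section \<open>Passage times and the circumradius\<close>

lemma emeasure_lborel_Ioi: "emeasure lborel {a<..} = (\<infinity>::ennreal)" for a :: real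
proof (rule ccontr)
  assume "emeasure lborel {a<..} \<noteq> (\<infinity>::ennreal)"
  then obtain r where r: "0 \<le> r" "emeasure lborel {a<..} = ennreal r"
    by (cases "emeasure lborel {a<..}") auto
  have "emeasure lborel {a<..<a + (r + 1)} \<le> emeasure lborel {a<..}"
    by (intro emeasure_mono) auto
  then show False using r by simp
qed

text \<open>In \<open>nn_integral_passage_time\<close> the event that level 1 is not yet exceeded
  lies between the strict and the weak variant.\<close>

lemma emeasure_ennreal_initial:
  fixes x :: ennreal
  shows "emeasure lborel {t. 0 \<le> t \<and> ennreal t < x} = x"
    and "emeasure lborel {t. 0 \<le> t \<and> ennreal t \<le> x} = x"
proof -
  have top: "emeasure lborel {0::real..} = \<infinity>"
  proof -
    have "emeasure lborel {0::real<..} \<le> emeasure lborel {0::real..}"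
      by (intro emeasure_mono) auto
    then show ?thesis by (simp add: emeasure_lborel_Ioi top_unique)
  qed
  have 1: "{t. 0 \<le> t \<and> ennreal t < ennreal r} = {0..<r}" "{t. 0 \<le> t \<and> ennreal t \<le> ennreal r} = {0..r}"
    if "0 \<le> r" for r
    using that by (auto simp: ennreal_less_iff)
  have 2: "{t. 0 \<le> t \<and> ennreal t < \<infinity>} = {0..}" "{t. 0 \<le> t \<and> ennreal t \<le> \<infinity>} = {0..}" by auto
  show "emeasure lborel {t. 0 \<le> t \<and> ennreal t < x} = x"
    using top 1 2 by (cases x) auto
  show "emeasure lborel {t. 0 \<le> t \<and> ennreal t \<le> x} = x"
    using top 1 2 by (cases x) auto
qed

lemma passage_time_antimono:
  assumes "\<And>t. 0 \<le> t \<Longrightarrow> X t \<omega> \<le> Y t \<omega>"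
  shows "passage_time Y \<omega> \<le> passage_time X \<omega>"
  unfolding passage_time_def using assms by (intro INF_superset_mono) (auto intro: less_le_trans)

text \<open>Turns \<open>range_constant\<close> into the mean passage time of a homogeneous
  functional of the ranges.\<close>

lemma passage_time_max:
  "passage_time (\<lambda>t \<omega>. max (X t \<omega>) (Y t \<omega>)) \<omega> = min (passage_time X \<omega>) (passage_time Y \<omega>)"
proof -
  have "{t. 0 \<le> t \<and> 1 < max (X t \<omega>) (Y t \<omega>)} = {t. 0 \<le> t \<and> 1 < X t \<omega>} \<union> {t. 0 \<le> t \<and> 1 < Y t \<omega>}"
    by (auto simp: less_max_iff_disj)
  then show ?thesis by (simp add: passage_time_def INF_union inf_min)
qed

text \<open>Up to null sets, {t < T} \<subseteq> {X' t \<le> 1} \<subseteq> {t \<le> T}, and for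
  each outcome both outer conditions hold on a set of times of length T. Fubini is applied to the
  outer sets, which are jointly measurable because T is; \<open>X'\<close> is measurable only at
  each fixed time.\<close>

lemma (in prob_space) nn_integral_passage_time:
  fixes X X' :: "real \<Rightarrow> 'a \<Rightarrow> real"
  assumes mono: "AE \<omega> in M. \<forall>s t. 0 \<le> s \<longrightarrow> s \<le> t \<longrightarrow> X s \<omega> \<le> X t \<omega>"
    and meas[measurable]: "\<And>t. 0 \<le> t \<Longrightarrow> X' t \<in> borel_measurable M"
    and eq: "\<And>t. 0 \<le> t \<Longrightarrow> AE \<omega> in M. X t \<omega> = X' t \<omega>"
  shows "(\<integral>\<^sup>+\<omega>. passage_time X \<omega> \<partial>M) = (\<integral>\<^sup>+t. emeasure M {\<omega>\<in>space M. X' t \<omega> \<le> 1} * indicator {0..} t \<partial>lborel)"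
proof -
  let ?Q = "{q::real. q \<in> \<rat> \<and> 0 \<le> q}"
  \<comment> \<open>A countable infimum is measurable, and for monotone paths rational times
    determine the passage time.\<close>
  define T where "T = (\<lambda>\<omega>. INF q\<in>?Q. if 1 < X' q \<omega> then ennreal q else \<infinity>)"
  have Q: "countable ?Q" using countable_rat by (rule countable_subset[rotated]) auto
  have T[measurable]: "T \<in> borel_measurable M"
    unfolding T_def by (intro borel_measurable_INF Q) auto
  have eqQ: "AE \<omega> in M. \<forall>q\<in>?Q. X q \<omega> = X' q \<omega>"
    using eq by (intro AE_ball_countable[THEN iffD2] Q) auto
  have PT: "AE \<omega> in M. passage_time X \<omega> = T \<omega>"
    using mono eqQ
  proof eventually_elim
    fix \<omega> assume m: "\<forall>s t. 0 \<le> s \<longrightarrow> s \<le> t \<longrightarrow> X s \<omega> \<le> X t \<omega>" and e: "\<forall>q\<in>?Q. X q \<omega> = X' q \<omega>"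
    show "passage_time X \<omega> = T \<omega>"
    proof (rule antisym)
      show "passage_time X \<omega> \<le> T \<omega>"
        unfolding T_def passage_time_def
      proof (rule INF_greatest)
        fix q assume "q \<in> ?Q"
        then show "(INF t\<in>{t. 0 \<le> t \<and> 1 < X t \<omega>}. ennreal t) \<le> (if 1 < X' q \<omega> then ennreal q else \<infinity>)"
          using e by (auto intro!: INF_lower)
      qed
      show "T \<omega> \<le> passage_time X \<omega>"
        unfolding passage_time_def
      proof (rule INF_greatest)
        fix t assume "t \<in> {t. 0 \<le> t \<and> 1 < X t \<omega>}"
        then have t: "0 \<le> t" "1 < X t \<omega>" by auto
        show "T \<omega> \<le> ennreal t"
        proof (rule ennreal_le_epsilon)
          fix \<epsilon> :: real assume "0 < \<epsilon>"
          obtain q where q: "q \<in> \<rat>" "t < q" "q < t + \<epsilon>"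
            using Rats_dense_in_real[of t "t + \<epsilon>"] \<open>0 < \<epsilon>\<close> by auto
          have "q \<in> ?Q" using q t by auto
          moreover have "X t \<omega> \<le> X q \<omega>" using m t q by auto
          ultimately have "1 < X' q \<omega>" using e t by auto
          then have "T \<omega> \<le> ennreal q"
            unfolding T_def using INF_lower[OF \<open>q \<in> ?Q\<close>, of "\<lambda>q. if 1 < X' q \<omega> then ennreal q else \<infinity>"] by simp
          also have "\<dots> \<le> ennreal t + ennreal \<epsilon>"
            using q t \<open>0 < \<epsilon>\<close> by (simp add: ennreal_plus[symmetric] ennreal_leI del: ennreal_plus)
          finally show "T \<omega> \<le> ennreal t + ennreal \<epsilon>" .
        qed
      qed
    qed
  qed
  interpret P: pair_sigma_finite M lborel by standard
  have fub: "(\<integral>\<^sup>+t. emeasure M {\<omega>\<in>space M. R t \<omega>} * indicator {0..} t \<partial>lborel) = (\<integral>\<^sup>+\<omega>. T \<omega> \<partial>M)"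
    if R[measurable]: "Measurable.pred (M \<Otimes>\<^sub>M borel) (\<lambda>p. R (snd p) (fst p))"
      and RT: "\<And>\<omega>. emeasure lborel {t. 0 \<le> t \<and> R t \<omega>} = T \<omega>" for R :: "real \<Rightarrow> 'a \<Rightarrow> bool"
  proof -
    have [measurable]: "Measurable.pred M (\<lambda>\<omega>. R t \<omega>)" for t
      using measurable_compose[OF _ R, of "\<lambda>\<omega>. (\<omega>, t)" M] by simp
    have [measurable]: "Measurable.pred borel (\<lambda>t. R t \<omega>)" if "\<omega> \<in> space M" for \<omega>
      using measurable_compose[OF _ R, of "\<lambda>t. (\<omega>, t)" borel] that by simp
    have "(\<integral>\<^sup>+t. emeasure M {\<omega>\<in>space M. R t \<omega>} * indicator {0..} t \<partial>lborel)
      = (\<integral>\<^sup>+t. (\<integral>\<^sup>+\<omega>. indicator {p\<in>space (M \<Otimes>\<^sub>M borel). R (snd p) (fst p)} (\<omega>, t) * indicator {0..} t \<partial>M) \<partial>lborel)"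
    proof (intro nn_integral_cong)
      fix t :: real
      have "(\<integral>\<^sup>+\<omega>. indicator {p\<in>space (M \<Otimes>\<^sub>M borel). R (snd p) (fst p)} (\<omega>, t) * indicator {0..} t \<partial>M)
         = (\<integral>\<^sup>+\<omega>. indicator {\<omega>\<in>space M. R t \<omega>} \<omega> * indicator {0..} t \<partial>M)"
        by (intro nn_integral_cong) (auto simp: indicator_def space_pair_measure)
      then show "emeasure M {\<omega>\<in>space M. R t \<omega>} * indicator {0..} t
         = (\<integral>\<^sup>+\<omega>. indicator {p\<in>space (M \<Otimes>\<^sub>M borel). R (snd p) (fst p)} (\<omega>, t) * indicator {0..} t \<partial>M)"
        by (simp add: nn_integral_multc)
    qed
    also have "\<dots> = (\<integral>\<^sup>+\<omega>. (\<integral>\<^sup>+t. indicator {p\<in>space (M \<Otimes>\<^sub>M borel). R (snd p) (fst p)} (\<omega>, t) * indicator {0..} t \<partial>lborel) \<partial>M)"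
      by (rule P.Fubini') measurable
    also have "\<dots> = (\<integral>\<^sup>+\<omega>. T \<omega> \<partial>M)"
    proof (intro nn_integral_cong)
      fix \<omega> assume \<omega>: "\<omega> \<in> space M"
      have "(\<integral>\<^sup>+t. indicator {p\<in>space (M \<Otimes>\<^sub>M borel). R (snd p) (fst p)} (\<omega>, t) * indicator {0..} t \<partial>lborel)
        = (\<integral>\<^sup>+t. indicator {t. 0 \<le> t \<and> R t \<omega>} t \<partial>lborel)"
        using \<omega> by (intro nn_integral_cong) (auto simp: indicator_def space_pair_measure)
      also have "\<dots> = emeasure lborel {t. 0 \<le> t \<and> R t \<omega>}"
      proof (rule nn_integral_indicator)
        have "{t\<in>space borel. 0 \<le> t \<and> R t \<omega>} \<in> sets borel" using \<omega> by measurable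
        then show "{t. 0 \<le> t \<and> R t \<omega>} \<in> sets lborel" by simp
      qed
      finally show "(\<integral>\<^sup>+t. indicator {p\<in>space (M \<Otimes>\<^sub>M borel). R (snd p) (fst p)} (\<omega>, t) * indicator {0..} t \<partial>lborel) = T \<omega>"
        by (simp add: RT)
    qed
    finally show ?thesis .
  qed
  have "(\<integral>\<^sup>+\<omega>. passage_time X \<omega> \<partial>M) = (\<integral>\<^sup>+\<omega>. T \<omega> \<partial>M)"
    by (rule nn_integral_cong_AE) (rule PT)
  moreover have "(\<integral>\<^sup>+\<omega>. T \<omega> \<partial>M) \<le> (\<integral>\<^sup>+t. emeasure M {\<omega>\<in>space M. X' t \<omega> \<le> 1} * indicator {0..} t \<partial>lborel)"
  proof -
    have "emeasure M {\<omega>\<in>space M. ennreal t < T \<omega>} \<le> emeasure M {\<omega>\<in>space M. X' t \<omega> \<le> 1}" if t: "0 \<le> t" for t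
    proof (rule emeasure_mono_AE)
      show "AE \<omega> in M. \<omega> \<in> {\<omega>\<in>space M. ennreal t < T \<omega>} \<longrightarrow> \<omega> \<in> {\<omega>\<in>space M. X' t \<omega> \<le> 1}"
        using PT eq[OF t]
      proof eventually_elim
        fix \<omega> assume "passage_time X \<omega> = T \<omega>" "X t \<omega> = X' t \<omega>"
        moreover have "passage_time X \<omega> \<le> ennreal t" if "1 < X t \<omega>"
          unfolding passage_time_def using that t by (intro INF_lower) auto
        ultimately show "\<omega> \<in> {\<omega>\<in>space M. ennreal t < T \<omega>} \<longrightarrow> \<omega> \<in> {\<omega>\<in>space M. X' t \<omega> \<le> 1}"
          by (auto simp: not_less[symmetric])
      qed
    qed (use t in measurable)
    then have "(\<integral>\<^sup>+t. emeasure M {\<omega>\<in>space M. ennreal t < T \<omega>} * indicator {0..} t \<partial>lborel) \<le> (\<integral>\<^sup>+t. emeasure M {\<omega>\<in>space M. X' t \<omega> \<le> 1} * indicator {0..} t \<partial>lborel)"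
      by (intro nn_integral_mono) (auto simp: indicator_def)
    then show ?thesis
      by (subst (asm) fub) (auto simp: emeasure_ennreal_initial)
  qed
  moreover have "(\<integral>\<^sup>+t. emeasure M {\<omega>\<in>space M. X' t \<omega> \<le> 1} * indicator {0..} t \<partial>lborel) \<le> (\<integral>\<^sup>+\<omega>. T \<omega> \<partial>M)"
  proof -
    have "emeasure M {\<omega>\<in>space M. X' t \<omega> \<le> 1} \<le> emeasure M {\<omega>\<in>space M. ennreal t \<le> T \<omega>}" if t: "0 \<le> t" for t
    proof (rule emeasure_mono_AE)
      show "AE \<omega> in M. \<omega> \<in> {\<omega>\<in>space M. X' t \<omega> \<le> 1} \<longrightarrow> \<omega> \<in> {\<omega>\<in>space M. ennreal t \<le> T \<omega>}"
        using PT eq[OF t] mono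
      proof eventually_elim
        fix \<omega> assume e: "passage_time X \<omega> = T \<omega>" "X t \<omega> = X' t \<omega>"
          and m: "\<forall>s t. 0 \<le> s \<longrightarrow> s \<le> t \<longrightarrow> X s \<omega> \<le> X t \<omega>"
        have "ennreal t \<le> passage_time X \<omega>" if 1: "X t \<omega> \<le> 1"
          unfolding passage_time_def
        proof (rule INF_greatest)
          fix s assume s: "s \<in> {t. 0 \<le> t \<and> 1 < X t \<omega>}"
          then have "t \<le> s" using m 1 t by (metis (mono_tags, lifting) linear mem_Collect_eq not_less order_trans)
          then show "ennreal t \<le> ennreal s" by (rule ennreal_leI)
        qed
        then show "\<omega> \<in> {\<omega>\<in>space M. X' t \<omega> \<le> 1} \<longrightarrow> \<omega> \<in> {\<omega>\<in>space M. ennreal t \<le> T \<omega>}"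
          using e by auto
      qed
    qed (use t in measurable)
    then have "(\<integral>\<^sup>+t. emeasure M {\<omega>\<in>space M. X' t \<omega> \<le> 1} * indicator {0..} t \<partial>lborel) \<le> (\<integral>\<^sup>+t. emeasure M {\<omega>\<in>space M. ennreal t \<le> T \<omega>} * indicator {0..} t \<partial>lborel)"
      by (intro nn_integral_mono) (auto simp: indicator_def)
    then show ?thesis
      by (subst (asm) (2) fub) (auto simp: emeasure_ennreal_initial)
  qed
  ultimately show ?thesis by (simp only: order.antisym)
qed

text \<open>The total length of the times s > 0 with q sqrt s \<le> 1. This explains the value
  \<infinity> for \<open>q \<le> 0\<close>, where the level is never exceeded.\<close>

definition inv_square :: "real \<Rightarrow> ennreal" where
  "inv_square q = (if q \<le> 0 then \<infinity> else ennreal (1 / q\<^sup>2))"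

lemma emeasure_sqrt_le:
  assumes t: "0 < t"
  shows "emeasure lborel {s. 0 < s \<and> q * sqrt s \<le> sqrt t} = ennreal t * inv_square q"
proof (cases "q \<le> 0")
  case True
  have "q * sqrt s \<le> sqrt t" if "0 < s" for s
    using True that t mult_nonpos_nonneg[of q "sqrt s"] by (meson order_trans real_sqrt_ge_zero less_imp_le)
  then have "{s. 0 < s \<and> q * sqrt s \<le> sqrt t} = {0<..}" by auto
  then show ?thesis using True t by (simp add: inv_square_def emeasure_lborel_Ioi ennreal_mult_top)
next
  case False
  then have q: "0 < q" by simp
  have "q * sqrt s \<le> sqrt t \<longleftrightarrow> s \<le> t / q\<^sup>2" if "0 < s" for s
  proof -
    have "q * sqrt s = sqrt (q\<^sup>2 * s)" using q by (simp add: real_sqrt_mult)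
    then show ?thesis using q by (simp add: field_simps)
  qed
  then have "{s. 0 < s \<and> q * sqrt s \<le> sqrt t} = {0<..t / q\<^sup>2}" by auto
  then show ?thesis using q t by (simp add: inv_square_def ennreal_mult[symmetric])
qed

lemma borel_measurable_inv_square [measurable]: "inv_square \<in> borel_measurable borel"
  unfolding inv_square_def by measurable

lemma inv_square_half: "inv_square (q / 2) = 4 * inv_square q"
  by (auto simp: inv_square_def power_divide ennreal_mult_top simp flip: ennreal_numeral ennreal_mult)

text \<open>The tangent to the convex function 1 / Q at Q = m, evaluated at Q = q^2: a pointwise
  form of Jensen's inequality. It is written with a sum because subtraction in
  \<open>ennreal\<close> truncates.\<close>

lemma inv_square_tangent:
  assumes "0 < m"
  shows "ennreal (2 / m) \<le> inv_square q + ennreal (q\<^sup>2 / m\<^sup>2)"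
proof (cases "q \<le> 0")
  case False
  then have q: "0 < q\<^sup>2" by simp
  have "0 \<le> (q\<^sup>2 - m)\<^sup>2 / (q\<^sup>2 * m\<^sup>2)" using q assms by simp
  also have "\<dots> = 1 / q\<^sup>2 + q\<^sup>2 / m\<^sup>2 - 2 / m"
  proof -
    have "1 / Q + Q / m\<^sup>2 - 2 / m = (Q - m)\<^sup>2 / (Q * m\<^sup>2)" if "0 < Q" for Q
      using that assms by (simp add: divide_simps) (simp add: algebra_simps power2_eq_square)
    then show ?thesis using q by simp
  qed
  finally have "2 / m \<le> 1 / q\<^sup>2 + q\<^sup>2 / m\<^sup>2" by simp
  then have "ennreal (2 / m) \<le> ennreal (1 / q\<^sup>2 + q\<^sup>2 / m\<^sup>2)" by (rule ennreal_leI)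
  then show ?thesis using False by (simp add: inv_square_def ennreal_plus)
qed (simp add: inv_square_def)


section \<open>Coordinate ranges and circumradius of a continuous path\<close>

definition path_range :: "real \<Rightarrow> (real \<Rightarrow> real) \<Rightarrow> real" where
  "path_range t w = (SUP s\<in>{0..t}. w s) - (INF s\<in>{0..t}. w s)"

lemma coord_range_eq: "coord_range W i t \<omega> = path_range t (\<lambda>s. W s \<omega> $ i)"
  by (simp add: coord_range_def path_range_def)

lemma bdd_continuous_image:
  fixes w :: "real \<Rightarrow> real"
  assumes "continuous_on {0..} w"
  shows "bdd_above (w ` {0..t})" "bdd_below (w ` {0..t})"
proof -
  have "compact (w ` {0..t})"
    using continuous_on_subset[OF assms, of "{0..t}"] by (intro compact_continuous_image) auto
  then have "bounded (w ` {0..t})" by (rule compact_imp_bounded)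
  then show "bdd_above (w ` {0..t})" "bdd_below (w ` {0..t})"
    by (rule bounded_imp_bdd_above bounded_imp_bdd_below)+
qed

lemma path_range_mono:
  assumes "continuous_on {0..} w" "0 \<le> s" "s \<le> t"
  shows "path_range s w \<le> path_range t w"
  unfolding path_range_def using assms bdd_continuous_image[OF assms(1), of t]
  by (intro diff_mono cSUP_subset_mono cINF_superset_mono) auto

lemma path_range_nonneg:
  assumes "continuous_on {0..} w" "0 \<le> t"
  shows "0 \<le> path_range t w"
  using path_range_mono[OF assms(1) order_refl assms(2)] by (simp add: path_range_def)

lemma grid_range_tendsto_path_range:
  assumes "continuous_on {0..} w" "0 \<le> t"
  shows "(\<lambda>n. grid_range n t w) \<longlonglongrightarrow> path_range t w"
  unfolding path_range_def
  using assms by (intro grid_range_tendsto continuous_on_subset[OF assms(1)]) auto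

lemma circumradius_bounds:
  fixes W :: "real \<Rightarrow> 'a \<Rightarrow> real ^ 2" and t :: real
  assumes c: "\<And>i. continuous_on {0..} (\<lambda>s. W s \<omega> $ i)" and t: "0 \<le> t"
  shows "max (coord_range W 1 t \<omega>) (coord_range W 2 t \<omega>) / 2 \<le> circumradius_process W t \<omega>"
    and "circumradius_process W t \<omega> \<le> sqrt ((coord_range W 1 t \<omega>)\<^sup>2 + (coord_range W 2 t \<omega>)\<^sup>2) / 2"
proof -
  let ?K = "(\<lambda>s. W s \<omega>) ` {0..t}"
  let ?s = "\<lambda>i. SUP s\<in>{0..t}. W s \<omega> $ i" and ?i = "\<lambda>i. INF s\<in>{0..t}. W s \<omega> $ i"
  let ?r = "sqrt ((coord_range W 1 t \<omega>)\<^sup>2 + (coord_range W 2 t \<omega>)\<^sup>2) / 2"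
  \<comment> \<open>The centre of the bounding rectangle; in each coordinate the path stays within
    half a side of it.\<close>
  define m :: "real ^ 2" where "m = (\<chi> i. (?s i + ?i i) / 2)"
  have "?K \<subseteq> cball m ?r"
  proof clarify
    fix s assume s: "s \<in> {0..t}"
    have 1: "\<bar>m $ i - W s \<omega> $ i\<bar> \<le> coord_range W i t \<omega> / 2" for i
    proof -
      have "W s \<omega> $ i \<le> ?s i" "?i i \<le> W s \<omega> $ i"
        using s bdd_continuous_image[OF c[of i], of t] by (auto intro: cSUP_upper cINF_lower)
      then show ?thesis by (simp add: m_def coord_range_def abs_le_iff field_simps)
    qed
    have "(m $ i - W s \<omega> $ i)\<^sup>2 \<le> (coord_range W i t \<omega> / 2)\<^sup>2" for i
      using power_mono[OF 1[of i], of 2] by simp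
    note this[of 1] this[of 2]
    then have "sqrt ((m $ 1 - W s \<omega> $ 1)\<^sup>2 + (m $ 2 - W s \<omega> $ 2)\<^sup>2) \<le> sqrt ((coord_range W 1 t \<omega> / 2)\<^sup>2 + (coord_range W 2 t \<omega> / 2)\<^sup>2)"
      by (intro real_sqrt_le_mono add_mono)
    also have "\<dots> = ?r"
      by (simp add: power_divide add_divide_distrib[symmetric] real_sqrt_divide)
    finally show "W s \<omega> \<in> cball m ?r"
      by (simp add: dist_norm norm_vec_def L2_set_def sum_2)
  qed
  then have hull: "hull_process W t \<omega> \<subseteq> cball m ?r"
    unfolding hull_process_def by (intro hull_minimal) auto
  then show "circumradius_process W t \<omega> \<le> ?r"
    unfolding circumradius_process_def circumradius_def
    by (intro cInf_lower bdd_belowI[of _ 0]) auto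
  \<comment> \<open>A disk whose radius is exactly the circumradius exists because the infimum is
    attained; it projects to an interval of twice that length on each axis.\<close>
  obtain z where z: "hull_process W t \<omega> \<subseteq> cball z (circumradius_process W t \<omega>)"
    using circumradius_attained(2)[OF bounded_subset[OF bounded_cball hull]] by (auto simp: circumradius_process_def)
  have "coord_range W i t \<omega> \<le> 2 * circumradius_process W t \<omega>" for i
  proof -
    have d: "\<bar>z $ i - W s \<omega> $ i\<bar> \<le> circumradius_process W t \<omega>" if "s \<in> {0..t}" for s
    proof -
      have "W s \<omega> \<in> hull_process W t \<omega>" unfolding hull_process_def using that by (intro hull_inc) auto
      then have "norm (z - W s \<omega>) \<le> circumradius_process W t \<omega>" using z by (auto simp: dist_norm)
      then show ?thesis using component_le_norm_cart[of "z - W s \<omega>" i] by simp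
    qed
    have "?s i \<le> z $ i + circumradius_process W t \<omega>"
      using t d by (intro cSUP_least) (auto simp: abs_le_iff algebra_simps)
    moreover have "z $ i - circumradius_process W t \<omega> \<le> ?i i"
      using t d by (intro cINF_greatest) (auto simp: abs_le_iff algebra_simps)
    ultimately show ?thesis by (simp add: coord_range_def)
  qed
  from this[of 1] this[of 2]
  show "max (coord_range W 1 t \<omega>) (coord_range W 2 t \<omega>) / 2 \<le> circumradius_process W t \<omega>" by simp
qed

text \<open>The instances are the maximum, its half and the half diagonal. Monotonicity is stated on
  the nonnegative quadrant, where the half diagonal has it; continuity carries grid values to the
  limit.\<close>

locale homogeneous_functional =
  fixes \<phi> :: "real \<Rightarrow> real \<Rightarrow> real"
  assumes continuous_pair: "continuous_on UNIV (\<lambda>p. \<phi> (fst p) (snd p))"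
    and monotone: "0 \<le> x \<Longrightarrow> x \<le> x' \<Longrightarrow> 0 \<le> y \<Longrightarrow> y \<le> y' \<Longrightarrow> \<phi> x y \<le> \<phi> x' y'"
    and homogeneous: "0 \<le> c \<Longrightarrow> \<phi> (c * x) (c * y) = c * \<phi> x y"
begin

lemma measurable_pair: "(\<lambda>p. \<phi> (fst p) (snd p)) \<in> borel_measurable (borel \<Otimes>\<^sub>M borel)"
  unfolding borel_prod by (rule borel_measurable_continuous_onI) (rule continuous_pair)

lemma measurable_functional [measurable (raw)]:
  assumes "f \<in> borel_measurable M" "g \<in> borel_measurable M"
  shows "(\<lambda>x. \<phi> (f x) (g x)) \<in> borel_measurable M"
  using measurable_compose[OF measurable_Pair[OF assms] measurable_pair] by simp

lemma tendsto_functional: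
  assumes "(f \<longlongrightarrow> a) F" "(g \<longlongrightarrow> b) F"
  shows "((\<lambda>x. \<phi> (f x) (g x)) \<longlongrightarrow> \<phi> a b) F"
  using continuous_on_tendsto_compose[OF continuous_pair tendsto_Pair[OF assms]] by simp

end

section \<open>Ranges of the planar motion and expected passage times by scaling\<close>

context planar_brownian_motion
begin

lemma coord: "standard_brownian_motion M (\<lambda>t \<omega>. W t \<omega> $ i)"
  using coord_1 coord_2 exhaust_2[of i] by auto

lemma measurable_coord: "0 \<le> t \<Longrightarrow> (\<lambda>\<omega>. W t \<omega> $ i) \<in> borel_measurable M"
  using standard_brownian_motion.measurable[OF coord] .

lemma AE_continuous: "AE \<omega> in M. \<forall>i. continuous_on {0..} (\<lambda>s. W s \<omega> $ i)"
  using standard_brownian_motion.continuous_paths[OF coord]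
  by (simp add: AE_all_countable)

definition coord_grid :: "nat \<Rightarrow> 2 \<Rightarrow> real \<Rightarrow> 'a \<Rightarrow> real" where
  "coord_grid n i t \<omega> = grid_range n t (\<lambda>s. W s \<omega> $ i)"

text \<open>A measurable version of \<^const>\<open>coord_range\<close>, which itself may fail to be measurable on the null set
  of discontinuous paths.\<close>

definition coord_lim :: "2 \<Rightarrow> real \<Rightarrow> 'a \<Rightarrow> real" where
  "coord_lim i t \<omega> = lim (\<lambda>n. coord_grid n i t \<omega>)"

lemma measurable_coord_grid [measurable]: "0 \<le> t \<Longrightarrow> coord_grid n i t \<in> borel_measurable M"
  unfolding coord_grid_def[abs_def] by (intro measurable_grid_range measurable_coord)

lemma measurable_coord_lim [measurable]: "0 \<le> t \<Longrightarrow> coord_lim i t \<in> borel_measurable M"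
  unfolding coord_lim_def[abs_def] by (intro borel_measurable_lim_metric measurable_coord_grid)

lemma coord_grid_tendsto_coord_range:
  assumes "continuous_on {0..} (\<lambda>s. W s \<omega> $ i)" "0 \<le> t"
  shows "(\<lambda>n. coord_grid n i t \<omega>) \<longlonglongrightarrow> coord_range W i t \<omega>"
  unfolding coord_grid_def coord_range_eq by (rule grid_range_tendsto_path_range[OF assms])

lemma AE_coord_lim_eq:
  assumes t: "0 \<le> t"
  shows "AE \<omega> in M. coord_lim i t \<omega> = coord_range W i t \<omega>"
  using AE_continuous
  by eventually_elim (use coord_grid_tendsto_coord_range[OF _ t] in \<open>auto simp: coord_lim_def intro: limI\<close>)

lemma AE_coord_grid_tendsto:
  assumes t: "0 \<le> t"
  shows "AE \<omega> in M. (\<lambda>n. coord_grid n i t \<omega>) \<longlonglongrightarrow> coord_lim i t \<omega>"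
  using AE_continuous AE_coord_lim_eq[OF t, of i]
  by eventually_elim (use coord_grid_tendsto_coord_range[OF _ t] in auto)

lemma AE_coord_grid_le:
  assumes t: "0 \<le> t"
  shows "AE \<omega> in M. coord_grid n i t \<omega> \<le> coord_lim i t \<omega>"
  using AE_coord_grid_tendsto[OF t, of i]
  by eventually_elim (rule incseq_le, auto simp: incseq_def coord_grid_def grid_range_mono)

text \<open>Fatou's lemma; the grid bound is uniform in \<open>n\<close>.\<close>

lemma coord_lim_second_moment:
  assumes t: "0 < t" "t < 1"
  shows "(\<integral>\<^sup>+\<omega>. ennreal ((coord_lim i t \<omega>)\<^sup>2) \<partial>M) \<le> ennreal (4 * ln 2)"
proof -
  have [measurable]: "coord_grid n i t \<in> borel_measurable M" for n using t by simp
  have "(\<integral>\<^sup>+\<omega>. ennreal ((coord_lim i t \<omega>)\<^sup>2) \<partial>M) = (\<integral>\<^sup>+\<omega>. liminf (\<lambda>n. ennreal ((coord_grid n i t \<omega>)\<^sup>2)) \<partial>M)"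
  proof (rule nn_integral_cong_AE)
    show "AE \<omega> in M. ennreal ((coord_lim i t \<omega>)\<^sup>2) = liminf (\<lambda>n. ennreal ((coord_grid n i t \<omega>)\<^sup>2))"
      using AE_coord_grid_tendsto[of t i, OF less_imp_le[OF t(1)]]
    proof eventually_elim
      case (elim \<omega>)
      then have "(\<lambda>n. ennreal ((coord_grid n i t \<omega>)\<^sup>2)) \<longlonglongrightarrow> ennreal ((coord_lim i t \<omega>)\<^sup>2)"
        by (intro tendsto_ennrealI tendsto_power)
      then show ?case by (intro lim_imp_Liminf[symmetric] trivial_limit_sequentially)
    qed
  qed
  also have "\<dots> \<le> liminf (\<lambda>n. \<integral>\<^sup>+\<omega>. ennreal ((coord_grid n i t \<omega>)\<^sup>2) \<partial>M)"
    by (rule nn_integral_liminf) measurable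
  also have "\<dots> \<le> limsup (\<lambda>n. \<integral>\<^sup>+\<omega>. ennreal ((coord_grid n i t \<omega>)\<^sup>2) \<partial>M)"
    by (rule Liminf_le_Limsup) simp
  also have "\<dots> \<le> ennreal (4 * ln 2)"
    using standard_brownian_motion.grid_range_second_moment[OF coord t]
    by (intro Limsup_bounded) (auto simp: coord_grid_def)
  finally show ?thesis .
qed

text \<open>Independence of the coordinate processes enters here. A grid range reads a path only at
  nonnegative times, so it is a measurable function on the product space.\<close>

lemma distr_coord_grid:
  assumes t: "0 < t"
  shows "distr M (borel \<Otimes>\<^sub>M borel) (\<lambda>\<omega>. (coord_grid n 1 t \<omega> / sqrt t, coord_grid n 2 t \<omega> / sqrt t)) =
    walk_range_law (1 / 2 ^ n) (2 ^ n) \<Otimes>\<^sub>M walk_range_law (1 / 2 ^ n) (2 ^ n)"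
proof -
  let ?f = "\<lambda>w. grid_range n t w / sqrt t"
  have f: "?f \<in> borel_measurable (PiM {0..} (\<lambda>_. borel))"
    using t by (intro borel_measurable_divide measurable_grid_range measurable_component_singleton) auto
  have g: "?f (restrict w {0..}) = ?f w" for w
    using t by (auto simp: grid_range_def grid_max_def intro!: arg_cong2[where f="(+)"] arg_cong[where f=Max] image_cong)
  show ?thesis
    using distr_pair_indep_var[OF indep_coords f f]
      standard_brownian_motion.distr_grid_range[OF coord t]
    by (simp add: g coord_grid_def)
qed

text \<open>On a grid both sides equal the mass of one set under one product of reference laws. Grid
  values increase to the limit, so the events decrease, and continuity from above gives convergence
  for every \<open>x\<close>, even at an atom of the limit law.\<close>

lemma prob_functional_scaling:
  assumes "homogeneous_functional \<phi>" and s: "0 < s" and t: "0 < t"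
  shows "prob {\<omega>\<in>space M. \<phi> (coord_lim 1 s \<omega>) (coord_lim 2 s \<omega>) \<le> x * sqrt s}
    = prob {\<omega>\<in>space M. \<phi> (coord_lim 1 t \<omega>) (coord_lim 2 t \<omega>) \<le> x * sqrt t}"
proof -
  interpret homogeneous_functional \<phi> by fact
  let ?\<mu> = "\<lambda>n. walk_range_law (1 / 2 ^ n) (2 ^ n) \<Otimes>\<^sub>M walk_range_law (1 / 2 ^ n) (2 ^ n)"
  have grid: "prob {\<omega>\<in>space M. \<phi> (coord_grid n 1 t \<omega>) (coord_grid n 2 t \<omega>) \<le> x * sqrt t}
      = measure (?\<mu> n) {p. \<phi> (fst p) (snd p) \<le> x}" if t: "0 < t" for n t
  proof -
    have [measurable]: "coord_grid n i t \<in> borel_measurable M" for i using t by simp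
    note [measurable] = measurable_pair
    have "{p\<in>space (borel \<Otimes>\<^sub>M borel). \<phi> (fst p) (snd p) \<le> x} \<in> sets (borel \<Otimes>\<^sub>M borel)" by measurable
    then have "measure (?\<mu> n) {p. \<phi> (fst p) (snd p) \<le> x}
       = prob ((\<lambda>\<omega>. (coord_grid n 1 t \<omega> / sqrt t, coord_grid n 2 t \<omega> / sqrt t)) -` {p. \<phi> (fst p) (snd p) \<le> x} \<inter> space M)"
      unfolding distr_coord_grid[OF t, symmetric] by (intro measure_distr) (auto simp: space_pair_measure)
    also have "(\<lambda>\<omega>. (coord_grid n 1 t \<omega> / sqrt t, coord_grid n 2 t \<omega> / sqrt t)) -` {p. \<phi> (fst p) (snd p) \<le> x} \<inter> space M
       = {\<omega>\<in>space M. \<phi> (coord_grid n 1 t \<omega>) (coord_grid n 2 t \<omega>) \<le> x * sqrt t}"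
    proof -
      have "\<phi> (a / sqrt t) (b / sqrt t) = \<phi> a b / sqrt t" for a b
        using homogeneous[of "1 / sqrt t" a b] t by simp
      then show ?thesis using t by (simp add: vimage_def Int_def pos_divide_le_eq conj_commute)
    qed
    finally show ?thesis ..
  qed
  have lim: "(\<lambda>n. prob {\<omega>\<in>space M. \<phi> (coord_grid n 1 t \<omega>) (coord_grid n 2 t \<omega>) \<le> x * sqrt t})
     \<longlonglongrightarrow> prob {\<omega>\<in>space M. \<phi> (coord_lim 1 t \<omega>) (coord_lim 2 t \<omega>) \<le> x * sqrt t}" if t: "0 < t" for t
  proof -
    let ?A = "\<lambda>n. {\<omega>\<in>space M. \<phi> (coord_grid n 1 t \<omega>) (coord_grid n 2 t \<omega>) \<le> x * sqrt t}"
    have [measurable]: "coord_grid n i t \<in> borel_measurable M" "coord_lim i t \<in> borel_measurable M" for i n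
      using t by auto
    have inc: "\<phi> (coord_grid m 1 t \<omega>) (coord_grid m 2 t \<omega>) \<le> \<phi> (coord_grid n 1 t \<omega>) (coord_grid n 2 t \<omega>)"
      if "m \<le> n" for m n \<omega>
      using that by (intro monotone) (auto simp: coord_grid_def grid_range_nonneg grid_range_mono)
    have "(\<lambda>n. prob (?A n)) \<longlonglongrightarrow> prob (\<Inter>n. ?A n)"
      by (rule finite_Lim_measure_decseq) (auto simp: decseq_def intro: order_trans[OF inc])
    also have "prob (\<Inter>n. ?A n) = prob {\<omega>\<in>space M. \<phi> (coord_lim 1 t \<omega>) (coord_lim 2 t \<omega>) \<le> x * sqrt t}"
    proof (rule measure_eq_AE)
      show "AE \<omega> in M. \<omega> \<in> (\<Inter>n. ?A n) \<longleftrightarrow> \<omega> \<in> {\<omega>\<in>space M. \<phi> (coord_lim 1 t \<omega>) (coord_lim 2 t \<omega>) \<le> x * sqrt t}"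
        using AE_coord_grid_tendsto[of t 1, OF less_imp_le[OF t]] AE_coord_grid_tendsto[of t 2, OF less_imp_le[OF t]]
      proof eventually_elim
        case (elim \<omega>)
        then have l: "(\<lambda>n. \<phi> (coord_grid n 1 t \<omega>) (coord_grid n 2 t \<omega>)) \<longlonglongrightarrow> \<phi> (coord_lim 1 t \<omega>) (coord_lim 2 t \<omega>)"
          by (intro tendsto_functional)
        have "\<phi> (coord_grid n 1 t \<omega>) (coord_grid n 2 t \<omega>) \<le> \<phi> (coord_lim 1 t \<omega>) (coord_lim 2 t \<omega>)" for n
          by (rule incseq_le[OF _ l]) (simp add: incseq_def inc)
        then show ?case using LIMSEQ_le_const2[OF l, of "x * sqrt t"] by (auto intro: order_trans)
      qed
    qed measurable
    finally show ?thesis .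
  qed
  show ?thesis
    using LIMSEQ_unique[OF lim[OF s, unfolded grid[OF s]] lim[OF t, unfolded grid[OF t]]] .
qed

lemma AE_coord_range_mono:
  "AE \<omega> in M. \<forall>i s t. 0 \<le> s \<longrightarrow> s \<le> t \<longrightarrow> 0 \<le> coord_range W i s \<omega> \<and> coord_range W i s \<omega> \<le> coord_range W i t \<omega>"
  using AE_continuous
  by eventually_elim (auto simp: coord_range_eq intro: path_range_nonneg path_range_mono)

text \<open>Layer cake in time, scaling to the fixed time \<open>t\<close>, then Fubini: for each
  outcome with Q > 0 the times s > 0 with Q sqrt s \<le> sqrt t have length t / Q^2. A general
  \<open>t\<close> is kept because the second moment bound is proved for
  \<open>t < 1\<close>.\<close>

lemma expected_passage_time:
  assumes "homogeneous_functional \<phi>" and t: "0 < t"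
  shows "(\<integral>\<^sup>+\<omega>. passage_time (\<lambda>s \<omega>. \<phi> (coord_range W 1 s \<omega>) (coord_range W 2 s \<omega>)) \<omega> \<partial>M)
    = ennreal t * (\<integral>\<^sup>+\<omega>. inv_square (\<phi> (coord_lim 1 t \<omega>) (coord_lim 2 t \<omega>)) \<partial>M)"
proof -
  interpret homogeneous_functional \<phi> by fact
  interpret P: pair_sigma_finite M lborel by standard
  let ?q = "\<lambda>\<omega>. \<phi> (coord_lim 1 t \<omega>) (coord_lim 2 t \<omega>)"
  have [measurable]: "coord_lim i t \<in> borel_measurable M" for i using t by simp
  have q[measurable]: "?q \<in> borel_measurable M" by measurable
  have "(\<integral>\<^sup>+\<omega>. passage_time (\<lambda>s \<omega>. \<phi> (coord_range W 1 s \<omega>) (coord_range W 2 s \<omega>)) \<omega> \<partial>M)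
    = (\<integral>\<^sup>+s. emeasure M {\<omega>\<in>space M. \<phi> (coord_lim 1 s \<omega>) (coord_lim 2 s \<omega>) \<le> 1} * indicator {0..} s \<partial>lborel)"
  proof (rule nn_integral_passage_time)
    show "AE \<omega> in M. \<forall>s t. 0 \<le> s \<longrightarrow> s \<le> t \<longrightarrow>
        \<phi> (coord_range W 1 s \<omega>) (coord_range W 2 s \<omega>) \<le> \<phi> (coord_range W 1 t \<omega>) (coord_range W 2 t \<omega>)"
      using AE_coord_range_mono by eventually_elim (auto intro!: monotone)
    show "(\<lambda>\<omega>. \<phi> (coord_lim 1 s \<omega>) (coord_lim 2 s \<omega>)) \<in> borel_measurable M" if "0 \<le> s" for s
      using that by (intro measurable_functional measurable_coord_lim)
    show "AE \<omega> in M. \<phi> (coord_range W 1 s \<omega>) (coord_range W 2 s \<omega>) = \<phi> (coord_lim 1 s \<omega>) (coord_lim 2 s \<omega>)"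
      if "0 \<le> s" for s
      using AE_coord_lim_eq[OF that, of 1] AE_coord_lim_eq[OF that, of 2] by eventually_elim simp
  qed
  also have "\<dots> = (\<integral>\<^sup>+s. emeasure M {\<omega>\<in>space M. ?q \<omega> * sqrt s \<le> sqrt t} * indicator {0<..} s \<partial>lborel)"
  proof (rule nn_integral_cong_AE, use AE_lborel_singleton[of 0] in eventually_elim)
    fix s :: real assume s0: "s \<noteq> 0"
    have "prob {\<omega>\<in>space M. \<phi> (coord_lim 1 s \<omega>) (coord_lim 2 s \<omega>) \<le> 1} = prob {\<omega>\<in>space M. ?q \<omega> * sqrt s \<le> sqrt t}"
      if s: "0 < s"
    proof -
      have "prob {\<omega>\<in>space M. \<phi> (coord_lim 1 s \<omega>) (coord_lim 2 s \<omega>) \<le> 1 / sqrt s * sqrt s}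
        = prob {\<omega>\<in>space M. ?q \<omega> \<le> 1 / sqrt s * sqrt t}"
        by (rule prob_functional_scaling[OF assms(1) s t])
      then show ?thesis using s by (simp add: field_simps)
    qed
    then show "emeasure M {\<omega>\<in>space M. \<phi> (coord_lim 1 s \<omega>) (coord_lim 2 s \<omega>) \<le> 1} * indicator {0..} s
       = emeasure M {\<omega>\<in>space M. ?q \<omega> * sqrt s \<le> sqrt t} * indicator {0<..} s"
      using s0 by (auto simp: indicator_def emeasure_eq_measure)
  qed
  also have "\<dots> = (\<integral>\<^sup>+s. (\<integral>\<^sup>+\<omega>. indicator {\<omega>\<in>space M. ?q \<omega> * sqrt s \<le> sqrt t} \<omega> * indicator {0<..} s \<partial>M) \<partial>lborel)"
    by (intro nn_integral_cong) (simp add: nn_integral_multc)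
  also have "\<dots> = (\<integral>\<^sup>+\<omega>. (\<integral>\<^sup>+s. indicator {\<omega>\<in>space M. ?q \<omega> * sqrt s \<le> sqrt t} \<omega> * indicator {0<..} s \<partial>lborel) \<partial>M)"
    by (rule P.Fubini') measurable
  also have "\<dots> = (\<integral>\<^sup>+\<omega>. ennreal t * inv_square (?q \<omega>) \<partial>M)"
  proof (intro nn_integral_cong)
    fix \<omega> assume \<omega>: "\<omega> \<in> space M"
    have "(\<integral>\<^sup>+s. indicator {\<omega>\<in>space M. ?q \<omega> * sqrt s \<le> sqrt t} \<omega> * indicator {0<..} s \<partial>lborel)
       = (\<integral>\<^sup>+s. indicator {s. 0 < s \<and> ?q \<omega> * sqrt s \<le> sqrt t} s \<partial>lborel)"
      using \<omega> by (intro nn_integral_cong) (auto simp: indicator_def)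
    also have "\<dots> = emeasure lborel {s. 0 < s \<and> ?q \<omega> * sqrt s \<le> sqrt t}"
      by (rule nn_integral_indicator) simp
    finally show "(\<integral>\<^sup>+s. indicator {\<omega>\<in>space M. ?q \<omega> * sqrt s \<le> sqrt t} \<omega> * indicator {0<..} s \<partial>lborel) = ennreal t * inv_square (?q \<omega>)"
      using emeasure_sqrt_le[OF t] by simp
  qed
  also have "\<dots> = ennreal t * (\<integral>\<^sup>+\<omega>. inv_square (?q \<omega>) \<partial>M)"
    by (rule nn_integral_cmult) measurable
  finally show ?thesis .
qed

lemma range_constant_eq:
  "range_constant M W = (\<integral>\<^sup>+\<omega>. passage_time (\<lambda>s \<omega>. max (coord_range W 1 s \<omega>) (coord_range W 2 s \<omega>)) \<omega> \<partial>M)"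
  by (simp add: range_constant_def passage_time_max)

text \<open>Without this the upper bound could be void. One coordinate suffices: its probability of
  not having exceeded 1 at time s is at most 1 up to s = 1 and at most 81 / s^2 afterwards.\<close>

lemma range_constant_finite: "range_constant M W < \<infinity>"
proof -
  have small: "emeasure M {\<omega>\<in>space M. coord_lim 1 t \<omega> \<le> 1} \<le> ennreal (81 / t\<^sup>2)" if t: "0 < t" for t
  proof -
    have [measurable]: "coord_grid 2 1 t \<in> borel_measurable M" "coord_lim 1 t \<in> borel_measurable M"
      using t by auto
    have "prob {\<omega>\<in>space M. coord_lim 1 t \<omega> \<le> 1} \<le> prob {\<omega>\<in>space M. coord_grid 2 1 t \<omega> \<le> 1}"
    proof (rule finite_measure_mono_AE)
      show "AE \<omega> in M. \<omega> \<in> {\<omega>\<in>space M. coord_lim 1 t \<omega> \<le> 1} \<longrightarrow> \<omega> \<in> {\<omega>\<in>space M. coord_grid 2 1 t \<omega> \<le> 1}"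
        using AE_coord_grid_le[of t 2 1, OF less_imp_le[OF t]] by eventually_elim auto
    qed measurable
    also have "\<dots> \<le> 81 / t\<^sup>2"
      using standard_brownian_motion.prob_grid_range_small[OF coord t] by (simp add: coord_grid_def)
    finally show ?thesis by (simp add: emeasure_eq_measure ennreal_leI)
  qed
  have "range_constant M W \<le> (\<integral>\<^sup>+\<omega>. passage_time (coord_range W 1) \<omega> \<partial>M)"
    unfolding range_constant_def by (intro nn_integral_mono) simp
  also have "\<dots> = (\<integral>\<^sup>+s. emeasure M {\<omega>\<in>space M. coord_lim 1 s \<omega> \<le> 1} * indicator {0..} s \<partial>lborel)"
  proof (rule nn_integral_passage_time)
    show "AE \<omega> in M. \<forall>s t. 0 \<le> s \<longrightarrow> s \<le> t \<longrightarrow> coord_range W 1 s \<omega> \<le> coord_range W 1 t \<omega>"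
      using AE_coord_range_mono by eventually_elim auto
    show "AE \<omega> in M. coord_range W 1 s \<omega> = coord_lim 1 s \<omega>" if "0 \<le> s" for s
      using AE_coord_lim_eq[OF that, of 1] by eventually_elim simp
  qed (rule measurable_coord_lim)
  also have "\<dots> \<le> (\<integral>\<^sup>+s. indicator {0..1} s + ennreal (81 / s\<^sup>2) * indicator {1..} s \<partial>lborel)"
  proof (intro nn_integral_mono)
    fix s :: real
    show "emeasure M {\<omega>\<in>space M. coord_lim 1 s \<omega> \<le> 1} * indicator {0..} s \<le> indicator {0..1} s + ennreal (81 / s\<^sup>2) * indicator {1..} s"
    proof (cases "1 < s")
      case True
      then show ?thesis using small[of s] by simp
    next
      case False
      then show ?thesis by (auto simp: indicator_def intro: order_trans[OF emeasure_le_1] add_increasing2)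
    qed
  qed
  also have "\<dots> = (\<integral>\<^sup>+s. indicator {0..1::real} s \<partial>lborel) + (\<integral>\<^sup>+s. ennreal (81 / s\<^sup>2) * indicator {1..} s \<partial>lborel)"
    by (rule nn_integral_add) auto
  also have "(\<integral>\<^sup>+s. ennreal (81 / s\<^sup>2) * indicator {1..} s \<partial>lborel) = ennreal (0 - (\<lambda>s. - 81 / s) 1)"
  proof (rule nn_integral_FTC_atLeast)
    show "((\<lambda>s. - 81 / s) has_real_derivative 81 / s\<^sup>2) (at s)" if "1 \<le> s" for s :: real
      using that by (auto intro!: derivative_eq_intros simp: power2_eq_square)
    show "((\<lambda>s. - 81 / s) \<longlongrightarrow> (0::real)) at_top"
      by (rule real_tendsto_divide_at_top[OF tendsto_const filterlim_ident])
  qed auto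
  also have "(\<integral>\<^sup>+s. indicator {0..1::real} s \<partial>lborel) + ennreal (0 - (\<lambda>s. - 81 / s) 1) < \<infinity>"
    by simp
  finally show ?thesis .
qed

section \<open>The two bounds for the circumradius\<close>

lemma passage_time_circumradius_bounds:
  "AE \<omega> in M.
     passage_time (\<lambda>s \<omega>. sqrt ((coord_range W 1 s \<omega>)\<^sup>2 + (coord_range W 2 s \<omega>)\<^sup>2) / 2) \<omega> \<le> passage_time (circumradius_process W) \<omega>
   \<and> passage_time (circumradius_process W) \<omega> \<le> passage_time (\<lambda>s \<omega>. max (coord_range W 1 s \<omega>) (coord_range W 2 s \<omega>) / 2) \<omega>"
  using AE_continuous
  by eventually_elim (intro conjI passage_time_antimono circumradius_bounds; simp)

lemma homogeneous_max_half: "homogeneous_functional (\<lambda>x y. max x y / 2)"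
  by unfold_locales (auto intro!: continuous_intros simp: max_mult_distrib_left max.coboundedI1 max.coboundedI2)

lemma homogeneous_max: "homogeneous_functional max"
  by unfold_locales (auto intro!: continuous_intros simp: max_mult_distrib_left max.coboundedI1 max.coboundedI2)

lemma homogeneous_diag_half: "homogeneous_functional (\<lambda>x y. sqrt (x\<^sup>2 + y\<^sup>2) / 2)"
proof
  show "continuous_on UNIV (\<lambda>p::real\<times>real. sqrt ((fst p)\<^sup>2 + (snd p)\<^sup>2) / 2)"
    by (intro continuous_intros) auto
  show "sqrt (x\<^sup>2 + y\<^sup>2) / 2 \<le> sqrt (x'\<^sup>2 + y'\<^sup>2) / 2" if "0 \<le> x" "x \<le> x'" "0 \<le> y" "y \<le> y'" for x x' y y' :: real
    using that by (intro divide_right_mono real_sqrt_le_mono add_mono power_mono) auto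
  show "sqrt ((c * x)\<^sup>2 + (c * y)\<^sup>2) / 2 = c * (sqrt (x\<^sup>2 + y\<^sup>2) / 2)" if "0 \<le> c" for c x y :: real
    using that by (simp add: power_mult_distrib distrib_left[symmetric] real_sqrt_mult)
qed

text \<open>Both expectations are reduced to inverse squares at time 1, where halving the functional
  multiplies by 4.\<close>

lemma passage_time_circumradius_upper:
  "(\<integral>\<^sup>+\<omega>. passage_time (circumradius_process W) \<omega> \<partial>M) \<le> 4 * range_constant M W"
proof -
  have [measurable]: "coord_lim i 1 \<in> borel_measurable M" for i by simp
  have "(\<integral>\<^sup>+\<omega>. passage_time (circumradius_process W) \<omega> \<partial>M)
    \<le> (\<integral>\<^sup>+\<omega>. passage_time (\<lambda>s \<omega>. max (coord_range W 1 s \<omega>) (coord_range W 2 s \<omega>) / 2) \<omega> \<partial>M)"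
    by (rule nn_integral_mono_AE) (use passage_time_circumradius_bounds in eventually_elim, simp)
  also have "\<dots> = (\<integral>\<^sup>+\<omega>. inv_square (max (coord_lim 1 1 \<omega>) (coord_lim 2 1 \<omega>) / 2) \<partial>M)"
    using expected_passage_time[OF homogeneous_max_half, of 1] by simp
  also have "\<dots> = 4 * (\<integral>\<^sup>+\<omega>. inv_square (max (coord_lim 1 1 \<omega>) (coord_lim 2 1 \<omega>)) \<partial>M)"
    unfolding inv_square_half by (rule nn_integral_cmult) measurable
  also have "\<dots> = 4 * range_constant M W"
    using expected_passage_time[OF homogeneous_max, of 1] by (simp add: range_constant_eq)
  finally show ?thesis .
qed

lemma passage_time_circumradius_lower:
  "ennreal (1 / (2 * ln 2)) \<le> (\<integral>\<^sup>+\<omega>. passage_time (circumradius_process W) \<omega> \<partial>M)"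
proof -
  \<comment> \<open>\<open>m\<close> is the bound (4 ln 2 + 4 ln 2) / 4 for the mean of the squared
    half diagonal. Taking the tangent at this point is optimal for a mean bounded by
    \<open>m\<close>.\<close>
  define m :: real where "m = 2 * ln 2"
  have m: "0 < m" by (simp add: m_def)
  let ?D = "\<lambda>x y. sqrt (x\<^sup>2 + y\<^sup>2) / 2"
  have lower: "ennreal (t / m) \<le> (\<integral>\<^sup>+\<omega>. passage_time (circumradius_process W) \<omega> \<partial>M)" if t: "0 < t" "t < 1" for t
  proof -
    have [measurable]: "coord_lim i t \<in> borel_measurable M" for i using t by simp
    let ?q = "\<lambda>\<omega>. ?D (coord_lim 1 t \<omega>) (coord_lim 2 t \<omega>)"
    let ?E = "\<integral>\<^sup>+\<omega>. inv_square (?q \<omega>) \<partial>M"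
    have "(\<integral>\<^sup>+\<omega>. ennreal ((?q \<omega>)\<^sup>2 / m\<^sup>2) \<partial>M) = (\<integral>\<^sup>+\<omega>. ennreal (1 / (4 * m\<^sup>2)) * (ennreal ((coord_lim 1 t \<omega>)\<^sup>2) + ennreal ((coord_lim 2 t \<omega>)\<^sup>2)) \<partial>M)"
      using m by (intro nn_integral_cong)
        (simp add: power_divide ennreal_plus[symmetric] ennreal_mult[symmetric] del: ennreal_plus)
    also have "\<dots> = ennreal (1 / (4 * m\<^sup>2)) * ((\<integral>\<^sup>+\<omega>. ennreal ((coord_lim 1 t \<omega>)\<^sup>2) \<partial>M) + (\<integral>\<^sup>+\<omega>. ennreal ((coord_lim 2 t \<omega>)\<^sup>2) \<partial>M))"
      by (simp add: nn_integral_cmult nn_integral_add)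
    also have "\<dots> \<le> ennreal (1 / (4 * m\<^sup>2)) * (ennreal (4 * ln 2) + ennreal (4 * ln 2))"
      by (intro mult_left_mono add_mono coord_lim_second_moment t) auto
    also have "\<dots> = ennreal (1 / (4 * m\<^sup>2) * (4 * ln 2 + 4 * ln 2))"
      by (simp add: ennreal_plus[symmetric] ennreal_mult[symmetric] del: ennreal_plus)
    also have "1 / (4 * m\<^sup>2) * (4 * ln 2 + 4 * ln 2) = 1 / m"
      by (simp add: m_def power2_eq_square)
    finally have 1: "(\<integral>\<^sup>+\<omega>. ennreal ((?q \<omega>)\<^sup>2 / m\<^sup>2) \<partial>M) \<le> ennreal (1 / m)" .
    have "ennreal (2 / m) = (\<integral>\<^sup>+\<omega>. ennreal (2 / m) \<partial>M)" by (simp add: emeasure_space_1)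
    also have "\<dots> \<le> (\<integral>\<^sup>+\<omega>. inv_square (?q \<omega>) + ennreal ((?q \<omega>)\<^sup>2 / m\<^sup>2) \<partial>M)"
      by (intro nn_integral_mono inv_square_tangent m)
    also have "\<dots> = ?E + (\<integral>\<^sup>+\<omega>. ennreal ((?q \<omega>)\<^sup>2 / m\<^sup>2) \<partial>M)"
      by (rule nn_integral_add) measurable
    also have "\<dots> \<le> ?E + ennreal (1 / m)" using 1 by (intro add_left_mono)
    finally have "ennreal (1 / m) + ennreal (1 / m) \<le> ?E + ennreal (1 / m)"
      using m by (simp add: ennreal_plus[symmetric] del: ennreal_plus)
    \<comment> \<open>\<open>ennreal (1 / m)\<close> is finite, so it cancels even if
      \<open>?E\<close> is infinite.\<close>
    then have E: "ennreal (1 / m) \<le> ?E" by (simp add: add.commute[of ?E] ennreal_add_left_cancel_le)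
    have "ennreal (t / m) = ennreal t * ennreal (1 / m)"
      using t m by (simp add: ennreal_mult[symmetric])
    also have "\<dots> \<le> ennreal t * ?E" using E by (rule mult_left_mono) simp
    also have "\<dots> = (\<integral>\<^sup>+\<omega>. passage_time (\<lambda>s \<omega>. ?D (coord_range W 1 s \<omega>) (coord_range W 2 s \<omega>)) \<omega> \<partial>M)"
      using expected_passage_time[OF homogeneous_diag_half t(1)] by simp
    also have "\<dots> \<le> (\<integral>\<^sup>+\<omega>. passage_time (circumradius_process W) \<omega> \<partial>M)"
      by (rule nn_integral_mono_AE) (use passage_time_circumradius_bounds in eventually_elim, simp)
    finally show ?thesis .
  qed
  \<comment> \<open>The expectation on the right of \<open>lower\<close> does not depend on
    \<open>t\<close>, so the reserve \<open>1 - t\<close> can now be let go to 0.\<close>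
  have "((\<lambda>t. ennreal (t / m)) \<longlongrightarrow> ennreal (1 / m)) (at_left 1)"
    using m by (intro tendsto_ennrealI tendsto_intros) auto
  then have "ennreal (1 / m) \<le> (\<integral>\<^sup>+\<omega>. passage_time (circumradius_process W) \<omega> \<partial>M)"
  proof (rule tendsto_upperbound)
    show "\<forall>\<^sub>F t in at_left 1. ennreal (t / m) \<le> (\<integral>\<^sup>+\<omega>. passage_time (circumradius_process W) \<omega> \<partial>M)"
      using lower by (auto simp: eventually_at_left_field intro!: exI[of _ 0])
  qed simp
  then show ?thesis by (simp add: m_def)
qed

end

theorem proposition1p10:
  fixes M :: "'a measure" and W :: "real \<Rightarrow> 'a \<Rightarrow> real ^ 2"
  assumes "planar_brownian_motion M W"
  shows "ennreal (1 / (2 * ln 2)) \<le> (\<integral>\<^sup>+\<omega>. passage_time (circumradius_process W) \<omega> \<partial>M) \<and>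
         (\<integral>\<^sup>+\<omega>. passage_time (circumradius_process W) \<omega> \<partial>M) \<le> 4 * range_constant M W \<and>
         range_constant M W < \<infinity>"
proof -
  interpret planar_brownian_motion M W by fact
  show ?thesis
    using passage_time_circumradius_lower passage_time_circumradius_upper range_constant_finite by blast
qed

end
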